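(* Let $(E^*,\breve h)$ be a Hamilton algebroid. There is a canonical metric structure on $\mathcal L^{*\pi}E$ (called a distinguished metric, or d-metric), defined by the Hamiltonian and the canonical N-connection it induces: $${}^{h}\breve{\mathbf g}={}^{h}\breve g_{ab}\,\mathbf z^a\otimes\mathbf z^b+{}^{h}\breve g^{ab}\,\breve{\mathbf v}_a\otimes\breve{\mathbf v}_b .$$
   Context: Summation over repeated indices. $\pi:E\to M$ is a rank $m$ vector bundle with Lie algebroid structure $([\cdot,\cdot],\rho)$; in a chart of $M$ (coordinates $x^i$) with a fixed local basis $v_a$ of sections of $E$, $\rho(v_a)=\rho^i_a(x)\partial/\partial x^i$, $[v_a,v_b]=C^c_{ab}(x)v_c$. ${}^{*}\pi:E^*\to M$ is the dual bundle with coordinates $(x^i,p_a)$. The prolongation over ${}^*\pi$ is $\mathcal L^{*\pi}E=\{(b,z)\in E\times TE^*:\rho(b)=T({}^*\pi)(z)\}$, a rank $2m$ vector bundle over $E^*$ via $(b,z)\mapsto\tau_{E^*}(z)$, with a local basis of sections $(\mathring z_a,\mathring v^a)$ whose anchors (images under $(b,z)\mapsto z$) are $\rho^i_a\partial/\partial x^i$, $\partial/\partial p_a$, and dual basis $(\mathring z^a,\mathring v_a)$. A metric on $\mathcal L^{*\pi}E$ is a symmetric nondegenerate covariant 2-tensor of constant signature on this vector bundle. A Hamilton algebroid is a pair $(E^*,\breve h)$ with $\breve h(x,p)$ differentiable on $\widetilde{E^*}=E^*\setminus\{0\}$ (zero section removed), continuous on the zero section, with ${}^{h}\breve g^{ab}=\frac12\frac{\partial^2\breve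 h}{\partial p_a\partial p_b}$ nondegenerate and of constant signature on $\widetilde{E^*}$; ${}^{h}\breve g_{ab}$ is the inverse matrix (everything is considered over $\widetilde{E^*}$). Poisson bracket: $\{f,w\}_{E^*}=\rho^i_a\big(\frac{\partial f}{\partial p_a}\frac{\partial w}{\partial x^i}-\frac{\partial f}{\partial x^i}\frac{\partial w}{\partial p_a}\big)+p_eC^e_{ab}\frac{\partial f}{\partial p_a}\frac{\partial w}{\partial p_b}$. The canonical N-connection has coefficients (over the chart with the fixed basis) $${}^{h}N_{ab}=\tfrac14\{{}^{h}\breve g_{ab},\breve h\}_{E^*}-\tfrac14\Big({}^{h}\breve g_{ac}\rho^i_b\frac{\partial^2\breve h}{\partial p_c\partial x^i}+{}^{h}\breve g_{bc}\rho^i_a\frac{\partial^2\breve h}{\partial p_c\partial x^i}\Big),$$ and $\mathbf z^a=\mathring z^a$, $\breve{\mathbf v}_a=\mathring v_a+{}^{h}N_{ba}\mathring z^b$.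
   Formalization: The metric is asserted over each chart of M with each fixed local basis v_a, not globally on the prolongation, because the given coefficients N_ab do not transform as an N-connection under a change of basis, so the local formulas need not agree on overlaps. *)

theory Defs
  imports "HOL-Analysis.Analysis" "HOL-Library.Function_Algebras"
begin

section \<open>Smooth maps, and functions as real vectors\<close>

text \<open>\<^term>\<open>S\<close> is meant to be open in the next two definitions.\<close>

primrec Ck_on :: "nat \<Rightarrow> 'a::real_normed_vector set \<Rightarrow> ('a \<Rightarrow> 'b::real_normed_vector) \<Rightarrow> bool" where
  "Ck_on 0 S F \<longleftrightarrow> continuous_on S F"
| "Ck_on (Suc k) S F \<longleftrightarrow> (\<forall>x\<in>S. F differentiable (at x)) \<and>
     (\<forall>v. Ck_on k S (\<lambda>x. frechet_derivative F (at x) v))"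

definition smooth_on :: "'a::real_normed_vector set \<Rightarrow> ('a \<Rightarrow> 'b::real_normed_vector) \<Rightarrow> bool" where
  "smooth_on S F \<longleftrightarrow> (\<forall>k. Ck_on k S F)"

text \<open>Tangent vectors are encoded below as functions on an atlas; this makes them a real vector
  type, so that \<^term>\<open>subspace\<close>, \<^term>\<open>independent\<close>, \<^term>\<open>representation\<close> apply to them.\<close>

instantiation "fun" :: (type, real_vector) real_vector
begin

definition scaleR_fun_def: "r *\<^sub>R F = (\<lambda>x. r *\<^sub>R F x)"

instance
  by standard (auto simp: scaleR_fun_def fun_eq_iff scaleR_add_right scaleR_add_left)

end


section \<open>Manifolds and tangent vectors\<close>

type_synonym ('q, 'b) chart = "'q set \<times> ('q \<Rightarrow> 'b)"

text \<open>The coordinate representation of a function on the manifold.\<close>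

definition in_chart :: "('q, 'b) chart \<Rightarrow> ('q \<Rightarrow> 'r) \<Rightarrow> 'b \<Rightarrow> 'r" where
  "in_chart c F = (\<lambda>y. F (inv_into (fst c) (snd c) y))"

definition smooth_atlas :: "('x::topological_space, 'b::euclidean_space) chart set \<Rightarrow> bool" where
  "smooth_atlas \<A> \<longleftrightarrow> (\<Union>c\<in>\<A>. fst c) = UNIV \<and>
     (\<forall>c\<in>\<A>. open (fst c) \<and> open (snd c ` fst c) \<and>
        homeomorphism (fst c) (snd c ` fst c) (snd c) (inv_into (fst c) (snd c))) \<and>
     (\<forall>c\<in>\<A>. \<forall>d\<in>\<A>. smooth_on (snd c ` (fst c \<inter> fst d)) (in_chart c (snd d)))"

text \<open>A tangent vector at \<^term>\<open>q\<close> is the family of its coordinate vectors in all charts around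
  \<^term>\<open>q\<close>, related by the derivatives of the transition maps (and \<^term>\<open>0\<close> elsewhere).\<close>

definition tangent_space ::
  "('q, 'b::real_normed_vector) chart set \<Rightarrow> 'q \<Rightarrow> (('q, 'b) chart \<Rightarrow> 'b) set" where
  "tangent_space \<A> q = {w.
     (\<forall>c. \<not> (c \<in> \<A> \<and> q \<in> fst c) \<longrightarrow> w c = 0) \<and>
     (\<forall>c\<in>\<A>. \<forall>d\<in>\<A>. q \<in> fst c \<inter> fst d \<longrightarrow>
        w d = frechet_derivative (in_chart c (snd d)) (at (snd c q)) (w c))}"

definition chart_at :: "('q, 'b) chart set \<Rightarrow> 'q \<Rightarrow> ('q, 'b) chart" where
  "chart_at \<A> q = (SOME c. c \<in> \<A> \<and> q \<in> fst c)"

text \<open>The tangent vector at \<^term>\<open>q\<close> with coordinate vector \<^term>\<open>v\<close> in the chart \<^term>\<open>c\<close>.\<close>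

definition coord_vector ::
  "('q, 'b::real_normed_vector) chart set \<Rightarrow> ('q, 'b) chart \<Rightarrow> 'q \<Rightarrow> 'b \<Rightarrow> ('q, 'b) chart \<Rightarrow> 'b" where
  "coord_vector \<A> c q v = (\<lambda>d. if d \<in> \<A> \<and> q \<in> fst d
     then frechet_derivative (in_chart c (snd d)) (at (snd c q)) v else 0)"

definition tangent_map ::
  "('q, 'b::real_normed_vector) chart set \<Rightarrow> ('r, 'c::real_normed_vector) chart set \<Rightarrow> ('q \<Rightarrow> 'r) \<Rightarrow> 'q \<Rightarrow>
   (('q, 'b) chart \<Rightarrow> 'b) \<Rightarrow> ('r, 'c) chart \<Rightarrow> 'c" where
  "tangent_map \<A> \<B> F q w = (let c = chart_at \<A> q in
     (\<lambda>d. if d \<in> \<B> \<and> F q \<in> fst d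
        then frechet_derivative (in_chart c (snd d \<circ> F)) (at (snd c q)) (w c) else 0))"

text \<open>The derivative of a function in the direction of a tangent vector.\<close>

definition vec_deriv ::
  "('q, 'b::real_normed_vector) chart set \<Rightarrow> 'q \<Rightarrow> (('q, 'b) chart \<Rightarrow> 'b) \<Rightarrow> ('q \<Rightarrow> real) \<Rightarrow> real" where
  "vec_deriv \<A> q w F = (let c = chart_at \<A> q in
     frechet_derivative (in_chart c F) (at (snd c q)) (w c))"


section \<open>Lie algebroids\<close>

text \<open>
  The base \<open>M\<close> is the type \<^typ>\<open>'x\<close> with the atlas \<open>charts\<close> (dimension \<open>CARD('n)\<close>).
  The fibres of \<open>E\<close> are subspaces of one real vector space \<^typ>\<open>'v\<close>; this is no restriction, as
  any family of vector spaces embeds in its direct sum. Only the linear structure of \<^typ>\<open>'v\<close>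
  matters: the smooth structure of \<open>E\<close> is given by a set of local frames, i.e. local bases of
  sections \<open>(V, e)\<close> with \<open>e x a\<close> the value of \<open>v\<^sub>a\<close> at \<open>x \<in> V\<close> (rank \<open>CARD('m)\<close>).

  The bracket \<open>bracket W s t\<close> is given for sections \<open>s, t\<close> over any open set \<open>W\<close>, compatibly with
  restrictions. A bracket on global sections extends uniquely to such a family, and this is
  what \<open>[v\<^sub>a, v\<^sub>b]\<close> means for a local basis \<open>v\<^sub>a\<close>.
\<close>

type_synonym ('x, 'v, 'm) frame = "'x set \<times> ('x \<Rightarrow> 'm \<Rightarrow> 'v)"

record ('x, 'v, 'n, 'm) algebroid =
  charts :: "('x, (real, 'n) vec) chart set"
  fibre :: "'x \<Rightarrow> 'v set"
  frames :: "('x, 'v, 'm) frame set"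
  anchor :: "'x \<Rightarrow> 'v \<Rightarrow> ('x, (real, 'n) vec) chart \<Rightarrow> (real, 'n) vec"
  bracket :: "'x set \<Rightarrow> ('x \<Rightarrow> 'v) \<Rightarrow> ('x \<Rightarrow> 'v) \<Rightarrow> 'x \<Rightarrow> 'v"

definition frame_coord :: "('x, 'v::real_vector, 'm::finite) frame \<Rightarrow> 'x \<Rightarrow> 'v \<Rightarrow> real^'m" where
  "frame_coord f x u = (\<chi> a. representation (range (snd f x)) u (snd f x a))"

definition smooth_fun ::
  "('x::topological_space, 'v, 'n::finite, 'm) algebroid \<Rightarrow> 'x set \<Rightarrow> ('x \<Rightarrow> real) \<Rightarrow> bool" where
  "smooth_fun A W F \<longleftrightarrow> (\<forall>c\<in>charts A. smooth_on (snd c ` (W \<inter> fst c)) (in_chart c F))"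

definition smooth_section ::
  "('x::topological_space, 'v::real_vector, 'n::finite, 'm::finite) algebroid \<Rightarrow> 'x set \<Rightarrow> ('x \<Rightarrow> 'v) \<Rightarrow> bool" where
  "smooth_section A W s \<longleftrightarrow> (\<forall>x\<in>W. s x \<in> fibre A x) \<and>
     (\<forall>c\<in>charts A. \<forall>f\<in>frames A.
        smooth_on (snd c ` (W \<inter> fst c \<inter> fst f)) (in_chart c (\<lambda>x. frame_coord f x (s x))))"

definition vector_bundle ::
  "('x::{t2_space,second_countable_topology}, 'v::real_vector, 'n::finite, 'm::finite) algebroid \<Rightarrow> bool" where
  "vector_bundle A \<longleftrightarrow> smooth_atlas (charts A) \<and>
     (\<forall>x. subspace (fibre A x)) \<and>
     (\<Union>f\<in>frames A. fst f) = UNIV \<and>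
     (\<forall>f\<in>frames A. open (fst f) \<and>
        (\<forall>x\<in>fst f. inj (snd f x) \<and> independent (range (snd f x)) \<and>
           span (range (snd f x)) = fibre A x) \<and>
        (\<forall>a. smooth_section A (fst f) (\<lambda>x. snd f x a)))"

definition smooth_anchor ::
  "('x::topological_space, 'v::real_vector, 'n::finite, 'm::finite) algebroid \<Rightarrow> bool" where
  "smooth_anchor A \<longleftrightarrow>
     (\<forall>x. \<forall>u\<in>fibre A x. anchor A x u \<in> tangent_space (charts A) x) \<and>
     (\<forall>x. \<forall>u\<in>fibre A x. \<forall>w\<in>fibre A x. anchor A x (u + w) = anchor A x u + anchor A x w) \<and>
     (\<forall>x r. \<forall>u\<in>fibre A x. anchor A x (r *\<^sub>R u) = r *\<^sub>R anchor A x u) \<and>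
     (\<forall>c\<in>charts A. \<forall>f\<in>frames A. \<forall>a.
        smooth_on (snd c ` (fst c \<inter> fst f)) (in_chart c (\<lambda>x. anchor A x (snd f x a) c)))"

text \<open>That the anchor is a homomorphism of Lie algebras follows from the Jacobi identity and the
  Leibniz rule.\<close>

definition lie_bracket ::
  "('x::topological_space, 'v::real_vector, 'n::finite, 'm::finite) algebroid \<Rightarrow> bool" where
  "lie_bracket A \<longleftrightarrow>
     (\<forall>W s t. open W \<longrightarrow> smooth_section A W s \<longrightarrow> smooth_section A W t \<longrightarrow>
        smooth_section A W (bracket A W s t) \<and>
        (\<forall>x\<in>W. bracket A W s t x = - bracket A W t s x) \<and>
        (\<forall>W' s' t'. open W' \<longrightarrow> W' \<subseteq> W \<longrightarrow>
           (\<forall>x\<in>W'. s' x = s x) \<longrightarrow> (\<forall>x\<in>W'. t' x = t x) \<longrightarrow>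
           (\<forall>x\<in>W'. bracket A W' s' t' x = bracket A W s t x)) \<and>
        (\<forall>u. smooth_section A W u \<longrightarrow> (\<forall>x\<in>W.
           bracket A W s (\<lambda>x. t x + u x) x = bracket A W s t x + bracket A W s u x \<and>
           bracket A W s (bracket A W t u) x + bracket A W t (bracket A W u s) x
             + bracket A W u (bracket A W s t) x = 0)) \<and>
        (\<forall>r. \<forall>x\<in>W. bracket A W s (\<lambda>x. r *\<^sub>R t x) x = r *\<^sub>R bracket A W s t x) \<and>
        (\<forall>F. smooth_fun A W F \<longrightarrow> (\<forall>x\<in>W.
           bracket A W s (\<lambda>x. F x *\<^sub>R t x) x =
             F x *\<^sub>R bracket A W s t x + vec_deriv (charts A) x (anchor A x (s x)) F *\<^sub>R t x)))"

definition lie_algebroid ::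
  "('x::{t2_space,second_countable_topology}, 'v::real_vector, 'n::finite, 'm::finite) algebroid \<Rightarrow> bool" where
  "lie_algebroid A \<longleftrightarrow> vector_bundle A \<and> smooth_anchor A \<and> lie_bracket A"

text \<open>\<open>\<rho>\<^sup>i\<^sub>a\<close> and \<open>C\<^sup>e\<^sub>a\<^sub>b\<close> as functions of the coordinates \<open>x\<^sup>i\<close> of a chart \<^term>\<open>c\<close>, for a
  frame \<^term>\<open>f\<close>.\<close>

definition rho ::
  "('x, 'v, 'n::finite, 'm) algebroid \<Rightarrow> ('x, real^'n) chart \<Rightarrow> ('x, 'v, 'm) frame \<Rightarrow> 'n \<Rightarrow> 'm \<Rightarrow> real^'n \<Rightarrow> real" where
  "rho A c f i a = in_chart c (\<lambda>x. anchor A x (snd f x a) c $ i)"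

definition structure_fun ::
  "('x, 'v::real_vector, 'n::finite, 'm::finite) algebroid \<Rightarrow> ('x, real^'n) chart \<Rightarrow> ('x, 'v, 'm) frame \<Rightarrow>
   'm \<Rightarrow> 'm \<Rightarrow> 'm \<Rightarrow> real^'n \<Rightarrow> real" where
  "structure_fun A c f e a b = in_chart c (\<lambda>x.
     frame_coord f x (bracket A (fst f) (\<lambda>x. snd f x a) (\<lambda>x. snd f x b) x) $ e)"


section \<open>The dual bundle and the prolongation\<close>

text \<open>Covectors are extended by \<^term>\<open>0\<close> outside the fibre.\<close>

definition dual_fibre :: "('x, 'v::real_vector, 'n, 'm) algebroid \<Rightarrow> 'x \<Rightarrow> ('v \<Rightarrow> real) set" where
  "dual_fibre A x = {\<alpha>.
     (\<forall>u\<in>fibre A x. \<forall>w\<in>fibre A x. \<alpha> (u + w) = \<alpha> u + \<alpha> w) \<and>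
     (\<forall>r. \<forall>u\<in>fibre A x. \<alpha> (r *\<^sub>R u) = r * \<alpha> u) \<and>
     (\<forall>u. u \<notin> fibre A x \<longrightarrow> \<alpha> u = 0)}"

definition dual_bundle :: "('x, 'v::real_vector, 'n, 'm) algebroid \<Rightarrow> ('x \<times> ('v \<Rightarrow> real)) set" where
  "dual_bundle A = Sigma UNIV (dual_fibre A)"

definition slit_dual :: "('x, 'v::real_vector, 'n, 'm) algebroid \<Rightarrow> ('x \<times> ('v \<Rightarrow> real)) set" where
  "slit_dual A = {\<mu> \<in> dual_bundle A. snd \<mu> \<noteq> 0}"

text \<open>The coordinates \<open>(x\<^sup>i, p\<^sub>a)\<close>.\<close>

definition dual_chart ::
  "('x, 'v::real_vector, 'n::finite, 'm::finite) algebroid \<Rightarrow> ('x, real^'n) chart \<Rightarrow> ('x, 'v, 'm) frame \<Rightarrow>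
   ('x \<times> ('v \<Rightarrow> real), (real^'n) \<times> (real^'m)) chart" where
  "dual_chart A c f =
     ({\<mu> \<in> dual_bundle A. fst \<mu> \<in> fst c \<inter> fst f},
      (\<lambda>\<mu>. (snd c (fst \<mu>), \<chi> a. snd \<mu> (snd f (fst \<mu>) a))))"

definition dual_charts ::
  "('x, 'v::real_vector, 'n::finite, 'm::finite) algebroid \<Rightarrow>
   ('x \<times> ('v \<Rightarrow> real), (real^'n) \<times> (real^'m)) chart set" where
  "dual_charts A = {dual_chart A c f | c f. c \<in> charts A \<and> f \<in> frames A}"

text \<open>Elements \<open>(b, z)\<close> of the prolongation over \<open>\<mu> \<in> E\<^sup>*\<close>; the base point of \<open>b\<close> is that
  of \<open>\<mu>\<close>, so only its fibre component is recorded.\<close>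

type_synonym ('x, 'v, 'n, 'm) prol_vec =
  "'v \<times> (('x \<times> ('v \<Rightarrow> real), (real, 'n) vec \<times> (real, 'm) vec) chart \<Rightarrow> (real, 'n) vec \<times> (real, 'm) vec)"

definition prolongation ::
  "('x, 'v::real_vector, 'n::finite, 'm::finite) algebroid \<Rightarrow> 'x \<times> ('v \<Rightarrow> real) \<Rightarrow> ('x, 'v, 'n, 'm) prol_vec set" where
  "prolongation A \<mu> = {(b, z). b \<in> fibre A (fst \<mu>) \<and> z \<in> tangent_space (dual_charts A) \<mu> \<and>
     anchor A (fst \<mu>) b = tangent_map (dual_charts A) (charts A) fst \<mu> z}"

text \<open>The local basis: \<^term>\<open>Inl a\<close> stands for \<open>z\<^sub>a\<close> and \<^term>\<open>Inr a\<close> for \<open>v\<^sup>a\<close> (both with a ring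
  above in the literature), lying over \<open>v\<^sub>a\<close> and \<open>0\<close> in \<open>E\<close>.\<close>

fun prol_basis ::
  "('x, 'v::real_vector, 'n::finite, 'm::finite) algebroid \<Rightarrow> ('x, real^'n) chart \<Rightarrow> ('x, 'v, 'm) frame \<Rightarrow>
   'x \<times> ('v \<Rightarrow> real) \<Rightarrow> 'm + 'm \<Rightarrow> ('x, 'v, 'n, 'm) prol_vec" where
  "prol_basis A c f \<mu> (Inl a) = (snd f (fst \<mu>) a,
     coord_vector (dual_charts A) (dual_chart A c f) \<mu>
       (\<chi> i. rho A c f i a (fst (snd (dual_chart A c f) \<mu>)), 0))"
| "prol_basis A c f \<mu> (Inr a) = (0,
     coord_vector (dual_charts A) (dual_chart A c f) \<mu> (0, axis a 1))"

text \<open>The dual basis.\<close>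

definition prol_cobasis ::
  "('x, 'v::real_vector, 'n::finite, 'm::finite) algebroid \<Rightarrow> ('x, real^'n) chart \<Rightarrow> ('x, 'v, 'm) frame \<Rightarrow>
   'x \<times> ('v \<Rightarrow> real) \<Rightarrow> 'm + 'm \<Rightarrow> ('x, 'v, 'n, 'm) prol_vec \<Rightarrow> real" where
  "prol_cobasis A c f \<mu> k X = representation (range (prol_basis A c f \<mu>)) X (prol_basis A c f \<mu> k)"


section \<open>Metrics\<close>

text \<open>\<open>B\<close> has \<open>p\<close> squares \<open>+1\<close> and \<open>q\<close> squares \<open>-1\<close> in some orthogonal basis of \<open>V\<close>. By Sylvester's
  law of inertia \<open>p\<close> and \<open>q\<close> are determined by \<open>B\<close>.\<close>

definition has_signature :: "'w::real_vector set \<Rightarrow> ('w \<Rightarrow> 'w \<Rightarrow> real) \<Rightarrow> nat \<Rightarrow> nat \<Rightarrow> bool" where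
  "has_signature V B p q \<longleftrightarrow> (\<exists>P N. finite P \<and> finite N \<and> P \<inter> N = {} \<and> card P = p \<and> card N = q \<and>
     independent (P \<union> N) \<and> span (P \<union> N) = V \<and>
     (\<forall>u\<in>P. B u u = 1) \<and> (\<forall>u\<in>N. B u u = -1) \<and>
     (\<forall>u\<in>P \<union> N. \<forall>w\<in>P \<union> N. u \<noteq> w \<longrightarrow> B u w = 0))"

definition bilinear_form_on :: "'w::real_vector set \<Rightarrow> ('w \<Rightarrow> 'w \<Rightarrow> real) \<Rightarrow> bool" where
  "bilinear_form_on V B \<longleftrightarrow>
     (\<forall>X\<in>V. \<forall>Y\<in>V. \<forall>Z\<in>V. B (X + Y) Z = B X Z + B Y Z \<and> B Z (X + Y) = B Z X + B Z Y) \<and>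
     (\<forall>r. \<forall>X\<in>V. \<forall>Y\<in>V. B (r *\<^sub>R X) Y = r * B X Y \<and> B X (r *\<^sub>R Y) = r * B X Y)"

text \<open>A metric on the prolongation over the part of the slit dual bundle that lies over the
  domain of a chart \<^term>\<open>c\<close> and a frame \<^term>\<open>f\<close>. The last clause is smoothness of the tensor
  field: its components in the local basis of the prolongation are smooth.\<close>

definition prolongation_metric ::
  "('x, 'v::real_vector, 'n::finite, 'm::finite) algebroid \<Rightarrow> ('x, real^'n) chart \<Rightarrow> ('x, 'v, 'm) frame \<Rightarrow>
   ('x \<times> ('v \<Rightarrow> real) \<Rightarrow> ('x, 'v, 'n, 'm) prol_vec \<Rightarrow> ('x, 'v, 'n, 'm) prol_vec \<Rightarrow> real) \<Rightarrow> bool" where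
  "prolongation_metric A c f g \<longleftrightarrow>
     (let D = slit_dual A \<inter> fst (dual_chart A c f) in
       (\<forall>\<mu>\<in>D. bilinear_form_on (prolongation A \<mu>) (g \<mu>)) \<and>
       (\<forall>\<mu>\<in>D. \<forall>X\<in>prolongation A \<mu>. \<forall>Y\<in>prolongation A \<mu>. g \<mu> X Y = g \<mu> Y X) \<and>
       (\<forall>\<mu>\<in>D. \<forall>X\<in>prolongation A \<mu>. (\<forall>Y\<in>prolongation A \<mu>. g \<mu> X Y = 0) \<longrightarrow> X = 0) \<and>
       (\<exists>p q. \<forall>\<mu>\<in>D. has_signature (prolongation A \<mu>) (g \<mu>) p q) \<and>
       (\<forall>k l. smooth_on (snd (dual_chart A c f) ` D)
          (in_chart (dual_chart A c f) (\<lambda>\<mu>. g \<mu> (prol_basis A c f \<mu> k) (prol_basis A c f \<mu> l)))))"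


section \<open>Hamilton algebroids and the canonical N-connection\<close>

definition pd_x :: "'n \<Rightarrow> ((real^'n::finite) \<times> (real^'m::finite) \<Rightarrow> real) \<Rightarrow> (real^'n) \<times> (real^'m) \<Rightarrow> real" where
  "pd_x i F w = frechet_derivative F (at w) (axis i 1, 0)"

definition pd_p :: "'m \<Rightarrow> ((real^'n::finite) \<times> (real^'m::finite) \<Rightarrow> real) \<Rightarrow> (real^'n) \<times> (real^'m) \<Rightarrow> real" where
  "pd_p a F w = frechet_derivative F (at w) (0, axis a 1)"

text \<open>In the remaining definitions \<^term>\<open>H\<close> is the Hamiltonian expressed in coordinates \<open>(x\<^sup>i, p\<^sub>a)\<close>:
  \<open>h_up\<close> is \<open>g\<^sup>a\<^sup>b\<close> and \<open>h_low\<close> is \<open>g\<^sub>a\<^sub>b\<close>.\<close>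

definition h_up :: "((real^'n::finite) \<times> (real^'m::finite) \<Rightarrow> real) \<Rightarrow> (real^'n) \<times> (real^'m) \<Rightarrow> real^'m^'m" where
  "h_up H w = (\<chi> a b. 1/2 * pd_p a (pd_p b H) w)"

definition h_low :: "((real^'n::finite) \<times> (real^'m::finite) \<Rightarrow> real) \<Rightarrow> (real^'n) \<times> (real^'m) \<Rightarrow> real^'m^'m" where
  "h_low H w = matrix_inv (h_up H w)"

definition hamilton_algebroid ::
  "('x::{t2_space,second_countable_topology}, 'v::real_vector, 'n::finite, 'm::finite) algebroid \<Rightarrow>
   ('x \<times> ('v \<Rightarrow> real) \<Rightarrow> real) \<Rightarrow> bool" where
  "hamilton_algebroid A h \<longleftrightarrow> lie_algebroid A \<and>
     (\<forall>c\<in>charts A. \<forall>f\<in>frames A. let d = dual_chart A c f; H = in_chart d h in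
        smooth_on (snd d ` (slit_dual A \<inter> fst d)) H \<and>
        continuous_on (snd d ` fst d) H \<and>
        (\<forall>\<mu>\<in>slit_dual A \<inter> fst d. invertible (h_up H (snd d \<mu>)))) \<and>
     (\<exists>p q. \<forall>c\<in>charts A. \<forall>f\<in>frames A. let d = dual_chart A c f; H = in_chart d h in
        \<forall>\<mu>\<in>slit_dual A \<inter> fst d.
          has_signature UNIV (\<lambda>v w. v \<bullet> (h_up H (snd d \<mu>) *v w)) p q)"

definition poisson ::
  "('x, 'v::real_vector, 'n::finite, 'm::finite) algebroid \<Rightarrow> ('x, real^'n) chart \<Rightarrow> ('x, 'v, 'm) frame \<Rightarrow>
   ((real^'n) \<times> (real^'m) \<Rightarrow> real) \<Rightarrow> ((real^'n) \<times> (real^'m) \<Rightarrow> real) \<Rightarrow> (real^'n) \<times> (real^'m) \<Rightarrow> real" where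
  "poisson A c f F G w =
     (\<Sum>i\<in>UNIV. \<Sum>a\<in>UNIV. rho A c f i a (fst w) * (pd_p a F w * pd_x i G w - pd_x i F w * pd_p a G w)) +
     (\<Sum>a\<in>UNIV. \<Sum>b\<in>UNIV. \<Sum>e\<in>UNIV.
        snd w $ e * structure_fun A c f e a b (fst w) * pd_p a F w * pd_p b G w)"

definition canonical_N ::
  "('x, 'v::real_vector, 'n::finite, 'm::finite) algebroid \<Rightarrow> ('x, real^'n) chart \<Rightarrow> ('x, 'v, 'm) frame \<Rightarrow>
   ((real^'n) \<times> (real^'m) \<Rightarrow> real) \<Rightarrow> 'm \<Rightarrow> 'm \<Rightarrow> (real^'n) \<times> (real^'m) \<Rightarrow> real" where
  "canonical_N A c f H a b w =
     1/4 * poisson A c f (\<lambda>w. h_low H w $ a $ b) H w -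
     1/4 * (\<Sum>e\<in>UNIV. \<Sum>i\<in>UNIV.
        h_low H w $ a $ e * rho A c f i b (fst w) * pd_p e (pd_x i H) w +
        h_low H w $ b $ e * rho A c f i a (fst w) * pd_p e (pd_x i H) w)"

text \<open>The coframe adapted to the N-connection.\<close>

definition z_co ::
  "('x, 'v::real_vector, 'n::finite, 'm::finite) algebroid \<Rightarrow> ('x, real^'n) chart \<Rightarrow> ('x, 'v, 'm) frame \<Rightarrow>
   'm \<Rightarrow> 'x \<times> ('v \<Rightarrow> real) \<Rightarrow> ('x, 'v, 'n, 'm) prol_vec \<Rightarrow> real" where
  "z_co A c f a \<mu> X = prol_cobasis A c f \<mu> (Inl a) X"

definition v_co ::
  "('x, 'v::real_vector, 'n::finite, 'm::finite) algebroid \<Rightarrow> ('x, real^'n) chart \<Rightarrow> ('x, 'v, 'm) frame \<Rightarrow>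
   ((real^'n) \<times> (real^'m) \<Rightarrow> real) \<Rightarrow> 'm \<Rightarrow> 'x \<times> ('v \<Rightarrow> real) \<Rightarrow> ('x, 'v, 'n, 'm) prol_vec \<Rightarrow> real" where
  "v_co A c f H a \<mu> X = prol_cobasis A c f \<mu> (Inr a) X +
     (\<Sum>b\<in>UNIV. canonical_N A c f H b a (snd (dual_chart A c f) \<mu>) * prol_cobasis A c f \<mu> (Inl b) X)"

end

theory Submission
  imports Defs
begin

text \<open>
  In the frame of the prolongation dual to the coframe adapted to the N-connection, the d-metric is
  block diagonal with blocks \<open>g\<^sub>a\<^sub>b\<close> and \<open>g\<^sup>a\<^sup>b\<close>, whatever the coefficients of the connection are.
  Multiplication by the matrix \<open>g\<^sup>a\<^sup>b\<close> is an isometry from its form to that of its inverse; hence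
  both blocks have the signature \<open>(p, q)\<close> of the Hamiltonian, and the metric is nondegenerate of
  constant signature \<open>(2p, 2q)\<close>. Smoothness follows since the inverse matrix (Cramer's rule) and the
  coefficients of the canonical N-connection are rational expressions in the momenta, the
  derivatives of the Hamiltonian, the anchor and the structure functions.
\<close>

section \<open>Calculus of smooth maps\<close>

text \<open>All calculus on the total space of E^* takes place in the images of its charts. These
  are products of an open set of base coordinates with R^m, and the transition maps between them are
  smooth because momenta transform linearly. The condition defining the prolongation ties the
  x-components of z to b and leaves the p-components free, so a chart and a frame identify each
  fibre with R^m x R^m without constraint. Every clause about the metric can then be pulled back
  along a linear bijection to a fixed space, where the form depends on the point only through the
  matrix \<open>g^{ab}\<close>. The witness bases demanded by \<open>has_signature\<close> are built
  from the basis supplied with the form of the Hamiltonian and transported along these maps; since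
  one pair \<open>p\<close>, \<open>q\<close> serves at every point, the resulting signature is
  constant.\<close>

lemma frechet_derivative_eqI: "(F has_derivative F') (at x) \<Longrightarrow> frechet_derivative F (at x) = F'"
  by (rule frechet_derivative_at[symmetric])

lemma frechet_derivative_cong_open:
  assumes "open S" "x \<in> S" "F differentiable (at x)" "\<And>y. y \<in> S \<Longrightarrow> F y = G y"
  shows "G differentiable (at x)" "frechet_derivative G (at x) = frechet_derivative F (at x)"
proof -
  have "(G has_derivative frechet_derivative F (at x)) (at x)"
    by (rule has_derivative_transform_within_open[OF _ assms(1,2,4)])
      (use assms(3) in \<open>simp_all flip: frechet_derivative_works\<close>)
  then show "G differentiable (at x)" "frechet_derivative G (at x) = frechet_derivative F (at x)"
    by (simp_all add: differentiableI frechet_derivative_eqI)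
qed

text \<open>A derivative at a point sees a whole neighbourhood, so agreement on \<open>S\<close>
  passes to the derivatives because \<open>S\<close> is open. This is why \<open>open S\<close>
  accompanies most of the closure rules below.\<close>

lemma Ck_on_cong:
  assumes "open S" "Ck_on k S F" "\<And>x. x \<in> S \<Longrightarrow> F x = G x"
  shows "Ck_on k S G"
  using assms(2,3)
proof (induction k arbitrary: F G)
  case 0
  then show ?case by (metis Ck_on.simps(1) continuous_on_cong)
next
  case (Suc k)
  have "G differentiable (at x)" "frechet_derivative F (at x) = frechet_derivative G (at x)"
    if "x \<in> S" for x
    using frechet_derivative_cong_open[OF assms(1) that, of F G] Suc.prems that by auto
  moreover have "Ck_on k S (\<lambda>x. frechet_derivative G (at x) v)" for v
    by (rule Suc.IH[of "\<lambda>x. frechet_derivative F (at x) v"]) (use Suc.prems calculation in auto)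
  ultimately show ?case by simp
qed

text \<open>Lets the closure rules work with the derivative that the calculus rules produce; the
  recursion then concerns its values on a fixed vector \<open>v\<close>, to which an induction
  hypothesis applies.\<close>

lemma Ck_on_SucI:
  assumes "open S" "\<And>x. x \<in> S \<Longrightarrow> (F has_derivative F' x) (at x)" "\<And>v. Ck_on k S (\<lambda>x. F' x v)"
  shows "Ck_on (Suc k) S F"
proof -
  have "Ck_on k S (\<lambda>x. frechet_derivative F (at x) v)" for v
    by (rule Ck_on_cong[OF assms(1) assms(3)[of v]]) (simp add: frechet_derivative_eqI[OF assms(2)])
  then show ?thesis
    using assms(2) by (auto simp: differentiable_def)
qed

lemma Ck_on_Suc_derivative:
  assumes "Ck_on (Suc k) S F" "x \<in> S"
  shows "(F has_derivative frechet_derivative F (at x)) (at x)"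
  using assms by (simp flip: frechet_derivative_works)

lemma Ck_on_SucD: "Ck_on (Suc k) S F \<Longrightarrow> Ck_on k S F"
proof (induction k arbitrary: F)
  case 0
  then show ?case
    using differentiable_at_withinI differentiable_imp_continuous_on differentiable_on_def
    by (metis Ck_on.simps)
qed (simp)

lemma Ck_on_const: "Ck_on k S (\<lambda>x. c)"
  by (induction k arbitrary: c) (auto simp: frechet_derivative_eqI[OF has_derivative_const])

lemma Ck_on_bounded_linear:
  assumes "bounded_linear L" "open S" "Ck_on k S F"
  shows "Ck_on k S (\<lambda>x. L (F x))"
  using assms(3)
proof (induction k arbitrary: F)
  case 0
  then show ?case using bounded_linear.continuous_on[OF assms(1)] by simp
next
  case (Suc k)
  show ?case
    by (rule Ck_on_SucI[OF assms(2) bounded_linear.has_derivative[OF assms(1)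
          Ck_on_Suc_derivative[OF Suc.prems]]]) (use Suc in simp_all)
qed

lemma Ck_on_add:
  assumes "open S" "Ck_on k S F" "Ck_on k S G"
  shows "Ck_on k S (\<lambda>x. F x + G x)"
  using assms(2,3)
proof (induction k arbitrary: F G)
  case 0
  then show ?case by (simp add: continuous_on_add)
next
  case (Suc k)
  show ?case
    by (rule Ck_on_SucI[OF assms(1) has_derivative_add[OF Suc.prems[THEN Ck_on_Suc_derivative]]])
      (use Suc in simp_all)
qed

text \<open>By the Leibniz rule each term of the derivative pairs one factor with the derivative of
  the other. The former is lowered from level \<open>Suc k\<close> to \<open>k\<close> by
  \<open>Ck_on_SucD\<close>, and the induction ranges over all \<open>F\<close> and
  \<open>G\<close>.\<close>

lemma Ck_on_bounded_bilinear:
  assumes "bounded_bilinear B" "open S" "Ck_on k S F" "Ck_on k S G"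
  shows "Ck_on k S (\<lambda>x. B (F x) (G x))"
  using assms(3,4)
proof (induction k arbitrary: F G)
  case 0
  then show ?case using bounded_bilinear.continuous_on[OF assms(1)] by simp
next
  case (Suc k)
  show ?case
  proof (rule Ck_on_SucI[OF assms(2)
        bounded_bilinear.FDERIV[OF assms(1) Suc.prems[THEN Ck_on_Suc_derivative]]])
    fix v
    have "Ck_on k S (\<lambda>x. frechet_derivative F (at x) v)" "Ck_on k S (\<lambda>x. frechet_derivative G (at x) v)"
      using Suc.prems by simp_all
    then show "Ck_on k S (\<lambda>x. B (F x) (frechet_derivative G (at x) v) + B (frechet_derivative F (at x) v) (G x))"
      using Suc.prems[THEN Ck_on_SucD] by (intro Ck_on_add assms(2) Suc.IH)
  qed
qed

text \<open>The derivative of \<open>inverse (F x)\<close> is a product of the derivative of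
  \<open>F\<close> and two copies of the inverse itself, now at level \<open>k\<close>, so the
  induction closes by the product rule.\<close>

lemma Ck_on_inverse:
  fixes F :: "'a::real_normed_vector \<Rightarrow> real"
  assumes "open S" "\<And>x. x \<in> S \<Longrightarrow> F x \<noteq> 0" "Ck_on k S F"
  shows "Ck_on k S (\<lambda>x. inverse (F x))"
  using assms(3)
proof (induction k)
  case 0
  then show ?case using assms(2) by (auto intro: continuous_intros)
next
  case (Suc k)
  note mult = Ck_on_bounded_bilinear[OF bounded_bilinear_mult assms(1)]
  note I = Suc.IH[OF Ck_on_SucD[OF Suc.prems]]
  have D: "Ck_on k S (\<lambda>x. frechet_derivative F (at x) v)" for v
    using Suc.prems by simp
  show ?case
    by (rule Ck_on_SucI[OF assms(1) Deriv.has_derivative_inverse[OF assms(2) Ck_on_Suc_derivative[OF Suc.prems]]])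
      (intro Ck_on_bounded_linear[OF bounded_linear_minus[OF bounded_linear_ident] assms(1)] mult I D | assumption)+
qed

text \<open>Carries functions of the base coordinates, such as the anchor coefficients and the
  structure functions, over to functions of (x, p). The derivative along \<open>v\<close> is again
  of this form, taken along \<open>fst v\<close>.\<close>

lemma Ck_on_compose_fst:
  fixes F :: "'a::real_normed_vector \<Rightarrow> 'c::real_normed_vector" and T :: "('a \<times> 'b::real_normed_vector) set"
  assumes "open T" "fst ` T \<subseteq> S" "Ck_on k S F"
  shows "Ck_on k T (\<lambda>w. F (fst w))"
  using assms(3)
proof (induction k arbitrary: F)
  case 0
  show ?case
    using 0 assms(2) continuous_on_compose2[of S F T fst] continuous_on_fst[OF continuous_on_id]
    by auto
next
  case (Suc k)
  have "((\<lambda>w. F (fst w)) has_derivative (\<lambda>v. frechet_derivative F (at (fst w)) (fst v))) (at w)"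
    if "w \<in> T" for w
    using has_derivative_compose[OF has_derivative_fst[OF has_derivative_ident]
        Ck_on_Suc_derivative[OF Suc.prems], of w] that assms(2) by auto
  then show ?case
    by (rule Ck_on_SucI[OF assms(1)])
      (use Suc.IH[of "\<lambda>x. frechet_derivative F (at x) _"] Suc.prems in simp_all)
qed

lemma smooth_on_cong:
  "open S \<Longrightarrow> smooth_on S F \<Longrightarrow> (\<And>x. x \<in> S \<Longrightarrow> F x = G x) \<Longrightarrow> smooth_on S G"
  unfolding smooth_on_def using Ck_on_cong[of S _ F G] by simp

lemma smooth_on_const: "smooth_on S (\<lambda>x. c)"
  by (simp add: smooth_on_def Ck_on_const)

lemma smooth_on_bounded_linear:
  "bounded_linear L \<Longrightarrow> open S \<Longrightarrow> smooth_on S F \<Longrightarrow> smooth_on S (\<lambda>x. L (F x))"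
  by (simp add: smooth_on_def Ck_on_bounded_linear)

lemma smooth_on_add:
  "open S \<Longrightarrow> smooth_on S F \<Longrightarrow> smooth_on S G \<Longrightarrow> smooth_on S (\<lambda>x. F x + G x)"
  by (simp add: smooth_on_def Ck_on_add)

lemma smooth_on_diff:
  assumes "open S" "smooth_on S F" "smooth_on S G" shows "smooth_on S (\<lambda>x. F x - G x)"
  using smooth_on_add[OF assms(1,2)
      smooth_on_bounded_linear[OF bounded_linear_minus[OF bounded_linear_ident] assms(1,3)]] by simp

lemma smooth_on_mult:
  fixes F G :: "'a::real_normed_vector \<Rightarrow> real"
  shows "open S \<Longrightarrow> smooth_on S F \<Longrightarrow> smooth_on S G \<Longrightarrow> smooth_on S (\<lambda>x. F x * G x)"
  by (simp add: smooth_on_def Ck_on_bounded_bilinear[OF bounded_bilinear_mult])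

lemma smooth_on_inverse:
  fixes F :: "'a::real_normed_vector \<Rightarrow> real"
  shows "open S \<Longrightarrow> smooth_on S F \<Longrightarrow> (\<And>x. x \<in> S \<Longrightarrow> F x \<noteq> 0) \<Longrightarrow> smooth_on S (\<lambda>x. inverse (F x))"
  by (simp add: smooth_on_def Ck_on_inverse)

lemma smooth_on_sum:
  "open S \<Longrightarrow> (\<And>i. i \<in> I \<Longrightarrow> smooth_on S (F i)) \<Longrightarrow> smooth_on S (\<lambda>x. \<Sum>i\<in>I. F i x)"
  by (induction I rule: infinite_finite_induct) (auto intro: smooth_on_add smooth_on_const)

lemma smooth_on_prod:
  fixes F :: "'i \<Rightarrow> 'a::real_normed_vector \<Rightarrow> real"
  shows "open S \<Longrightarrow> (\<And>i. i \<in> I \<Longrightarrow> smooth_on S (F i)) \<Longrightarrow> smooth_on S (\<lambda>x. \<Prod>i\<in>I. F i x)"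
  by (induction I rule: infinite_finite_induct) (auto intro: smooth_on_mult smooth_on_const)

lemma smooth_on_compose_fst:
  "open T \<Longrightarrow> fst ` T \<subseteq> S \<Longrightarrow> smooth_on S F \<Longrightarrow> smooth_on T (\<lambda>w. F (fst w))"
  by (simp add: smooth_on_def Ck_on_compose_fst)

lemma smooth_on_frechet_derivative:
  "smooth_on S F \<Longrightarrow> smooth_on S (\<lambda>x. frechet_derivative F (at x) v)"
  using Ck_on.simps(2) unfolding smooth_on_def by blast

lemma smooth_on_imp_differentiable: "smooth_on S F \<Longrightarrow> x \<in> S \<Longrightarrow> F differentiable (at x)"
  using Ck_on.simps(2) unfolding smooth_on_def by blast

lemma smooth_on_linear:
  assumes "bounded_linear L" "open S"
  shows "smooth_on S L"
proof -
  have "Ck_on k S L" for k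
  proof (cases k)
    case 0
    then show ?thesis by (simp add: linear_continuous_on assms)
  next
    case (Suc j)
    then show ?thesis
      using Ck_on_SucI[OF assms(2) bounded_linear_imp_has_derivative[OF assms(1)] Ck_on_const] by simp
  qed
  then show ?thesis by (simp add: smooth_on_def)
qed

lemma smooth_on_vec_nth: "open S \<Longrightarrow> smooth_on S F \<Longrightarrow> smooth_on S (\<lambda>x. F x $ i)"
  by (rule smooth_on_bounded_linear[OF bounded_linear_vec_nth])

section \<open>Determinants and inverse matrices\<close>

lemma smooth_on_det:
  fixes F :: "'a::real_normed_vector \<Rightarrow> real^'m^'m"
  assumes "open S" "\<And>i j. smooth_on S (\<lambda>x. F x $ i $ j)"
  shows "smooth_on S (\<lambda>x. det (F x))"
  unfolding det_def
  by (intro smooth_on_sum smooth_on_mult smooth_on_prod smooth_on_const assms)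

lemma matrix_inv_works:
  assumes "invertible A"
  shows "A ** matrix_inv A = mat 1" "matrix_inv A ** A = mat 1"
  using someI_ex[OF assms[unfolded invertible_def]] by (simp_all add: matrix_inv_def)

lemma smooth_on_matrix_inv:
  fixes F :: "'a::real_normed_vector \<Rightarrow> real^'m^'m"
  assumes S: "open S" and F: "\<And>i j. smooth_on S (\<lambda>x. F x $ i $ j)"
    and inv: "\<And>x. x \<in> S \<Longrightarrow> invertible (F x)"
  shows "smooth_on S (\<lambda>x. matrix_inv (F x) $ i $ j)"
proof -
  \<comment> \<open>Column \<open>j\<close> of the inverse solves
    \<open>F x *v y = axis j 1\<close>; Cramer's rule gives its entry \<open>i\<close> after column
    \<open>i\<close> of \<open>F x\<close> is replaced by \<open>axis j 1\<close>.\<close>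
  let ?M = "\<lambda>x. (\<chi> k l. if l = i then axis j 1 $ k else F x $ k $ l) :: real^'m^'m"
  have M: "smooth_on S (\<lambda>x. ?M x $ k $ l)" for k l
    by (cases "l = i") (auto intro: smooth_on_const F)
  have det: "x \<in> S \<Longrightarrow> det (F x) \<noteq> 0" for x
    using inv invertible_det_nz by blast
  have "smooth_on S (\<lambda>x. det (?M x) * inverse (det (F x)))"
    by (intro smooth_on_mult smooth_on_inverse smooth_on_det S F M det)
  moreover have "det (?M x) * inverse (det (F x)) = matrix_inv (F x) $ i $ j" if "x \<in> S" for x
  proof -
    have "F x *v (matrix_inv (F x) *v axis j 1) = axis j 1"
      by (simp add: matrix_vector_mul_assoc matrix_inv_works[OF inv[OF that]])
    then have "(matrix_inv (F x) *v axis j 1) $ i = det (?M x) / det (F x)"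
      using cramer[OF det[OF that], of "matrix_inv (F x) *v axis j 1" "axis j 1"] by simp
    then show ?thesis
      by (simp add: matrix_vector_mult_basis column_def divide_inverse)
  qed
  ultimately show ?thesis by (rule smooth_on_cong[OF S])
qed

section \<open>Signatures\<close>

text \<open>Transports a witness basis. The target is \<open>range L\<close> because
  \<open>L\<close> will be an invertible matrix in one use and the identification of R^m x R^m with
  a fibre of the prolongation, a proper subspace of its type, in the other.\<close>

lemma has_signature_linear_image:
  assumes "linear L" "inj L" "has_signature UNIV B p q" "\<And>x y. B' (L x) (L y) = B x y"
  shows "has_signature (range L) B' p q"
proof -
  obtain P N where PN: "finite P" "finite N" "P \<inter> N = {}" "card P = p" "card N = q"
     "independent (P \<union> N)" "span (P \<union> N) = UNIV"
     "\<forall>u\<in>P. B u u = 1" "\<forall>u\<in>N. B u u = -1"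
     "\<forall>u\<in>P \<union> N. \<forall>w\<in>P \<union> N. u \<noteq> w \<longrightarrow> B u w = 0"
    using assms(3) unfolding has_signature_def by (elim exE conjE) (rule that)
  have inj: "inj_on L X" for X
    using assms(2) inj_on_subset by blast
  have "L ` P \<inter> L ` N = {}"
    using PN(3) assms(2) by (auto simp: inj_eq)
  moreover have "independent (L ` P \<union> L ` N)"
    using linear_independent_injective_image[OF assms(1) PN(6) inj] by (simp add: image_Un)
  moreover have "span (L ` P \<union> L ` N) = range L"
    using linear_span_image[OF assms(1), of "P \<union> N"] PN(7) by (simp add: image_Un)
  moreover have "card (L ` P) = p" "card (L ` N) = q"
    using PN(4,5) card_image[OF inj] by simp_all
  moreover have "\<forall>u\<in>L ` P \<union> L ` N. \<forall>w\<in>L ` P \<union> L ` N. u \<noteq> w \<longrightarrow> B' u w = 0"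
    using PN(10) unfolding image_Un[symmetric] by (simp add: assms(4) inj_eq[OF assms(2)] del: image_Un)
  ultimately show ?thesis
    unfolding has_signature_def using PN(1,2,8,9) assms(4)
    by (intro exI[of _ "L ` P"] exI[of _ "L ` N"]) simp
qed

text \<open>If \<open>a\<close> were in the span of the other elements, the linear map
  \<open>B a\<close> would vanish at \<open>a\<close> as it does on them.\<close>

lemma independent_if_orthogonal:
  assumes B: "bilinear (B :: 'w::real_vector \<Rightarrow> 'w \<Rightarrow> real)"
    and "\<And>u. u \<in> S \<Longrightarrow> B u u \<noteq> 0" "\<And>u w. u \<in> S \<Longrightarrow> w \<in> S \<Longrightarrow> u \<noteq> w \<Longrightarrow> B u w = 0"
  shows "independent S"
  unfolding real_vector.dependent_def
proof safe
  fix a assume a: "a \<in> S" "a \<in> span (S - {a})"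
  have "linear (B a)" using B by (simp add: bilinear_def)
  then have "B a a = 0"
    by (rule linear_eq_0_on_span[OF _ _ a(2)]) (use assms(3) a(1) in auto)
  with assms(2) a(1) show False by blast
qed

text \<open>Signatures add on an orthogonal sum: the witness bases are embedded in the two factors,
  and orthogonality with squares 1 and -1 makes their union independent.\<close>

lemma has_signature_prod:
  fixes B :: "'a::real_vector \<Rightarrow> 'a \<Rightarrow> real" and C :: "'b::real_vector \<Rightarrow> 'b \<Rightarrow> real"
  assumes B: "bilinear B" and C: "bilinear C"
    and "has_signature UNIV B p q" "has_signature UNIV C p' q'"
  shows "has_signature UNIV (\<lambda>s t. B (fst s) (fst t) + C (snd s) (snd t)) (p + p') (q + q')"
proof -
  obtain P N where PN: "finite P" "finite N" "P \<inter> N = {}" "card P = p" "card N = q"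
     "independent (P \<union> N)" "span (P \<union> N) = UNIV"
     "\<forall>u\<in>P. B u u = 1" "\<forall>u\<in>N. B u u = -1"
     "\<forall>u\<in>P \<union> N. \<forall>w\<in>P \<union> N. u \<noteq> w \<longrightarrow> B u w = 0"
    using assms(3) unfolding has_signature_def by (elim exE conjE) (rule that)
  obtain P' N' where PN': "finite P'" "finite N'" "P' \<inter> N' = {}" "card P' = p'" "card N' = q'"
     "independent (P' \<union> N')" "span (P' \<union> N') = UNIV"
     "\<forall>u\<in>P'. C u u = 1" "\<forall>u\<in>N'. C u u = -1"
     "\<forall>u\<in>P' \<union> N'. \<forall>w\<in>P' \<union> N'. u \<noteq> w \<longrightarrow> C u w = 0"
    using assms(4) unfolding has_signature_def by (elim exE conjE) (rule that)
  note zero[simp] = bilinear_lzero[OF B] bilinear_rzero[OF B] bilinear_lzero[OF C] bilinear_rzero[OF C]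
  define F where "F = (\<lambda>s t. B (fst s) (fst t) + C (snd s) (snd t))"
  define PP where "PP = P \<times> {0} \<union> {0} \<times> P'"
  define NN where "NN = N \<times> {0} \<union> {0} \<times> N'"
  have U: "PP \<union> NN = (P \<union> N) \<times> {0} \<union> {0} \<times> (P' \<union> N')"
    by (auto simp: PP_def NN_def)
  \<comment> \<open>The embedded copies of the two bases could only meet in \<open>(0, 0)\<close>;
    excluding the zero vector keeps them disjoint, so cardinalities add.\<close>
  have nz: "0 \<notin> P" "0 \<notin> N" "0 \<notin> P'" "0 \<notin> N'"
    using PN(6) PN'(6) dependent_zero by blast+
  have "bilinear F"
    using B C unfolding F_def bilinear_def
    by (auto intro!: linear_compose_add linear_compose[OF linear_fst, unfolded o_def]
        linear_compose[OF linear_snd, unfolded o_def])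
  moreover have diag: "\<forall>u\<in>PP. F u u = 1" "\<forall>u\<in>NN. F u u = -1"
    using PN(8,9) PN'(8,9) by (auto simp: F_def PP_def NN_def)
  moreover have orth: "\<forall>u\<in>PP \<union> NN. \<forall>w\<in>PP \<union> NN. u \<noteq> w \<longrightarrow> F u w = 0"
  proof (intro ballI impI)
    fix u w assume "u \<in> PP \<union> NN" "w \<in> PP \<union> NN" "u \<noteq> w"
    then consider a b where "u = (a, 0)" "w = (b, 0)" "a \<in> P \<union> N" "b \<in> P \<union> N" "a \<noteq> b"
      | a b where "u = (0, a)" "w = (0, b)" "a \<in> P' \<union> N'" "b \<in> P' \<union> N'" "a \<noteq> b"
      | a b where "u = (a, 0)" "w = (0, b)" | a b where "u = (0, a)" "w = (b, 0)"
      unfolding U by blast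
    then show "F u w = 0"
      using PN(10) PN'(10) by cases (simp_all add: F_def del: Un_iff)
  qed
  ultimately have "independent (PP \<union> NN)"
    by (intro independent_if_orthogonal[of F]) auto
  moreover have "span (PP \<union> NN) = UNIV"
  proof -
    have "(x, y) \<in> span (PP \<union> NN)" for x y
    proof -
      have lin: "linear (\<lambda>x::'a. (x, 0::'b))" "linear (\<lambda>y::'b. (0::'a, y))"
        by (auto intro: linearI)
      have "(x, 0) \<in> span ((\<lambda>x. (x, 0::'b)) ` (P \<union> N))" "(0::'a, y) \<in> span ((\<lambda>y. (0, y)) ` (P' \<union> N'))"
        unfolding linear_span_image[OF lin(1)] linear_span_image[OF lin(2)] PN(7) PN'(7) by simp_all
      moreover have "(\<lambda>x. (x, 0)) ` (P \<union> N) \<subseteq> PP \<union> NN" "(\<lambda>y. (0, y)) ` (P' \<union> N') \<subseteq> PP \<union> NN"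
        unfolding U by auto
      ultimately have "(x, 0) \<in> span (PP \<union> NN)" "(0, y) \<in> span (PP \<union> NN)"
        using span_mono subsetD by metis+
      then show ?thesis
        using span_add[of "(x, 0)" _ "(0, y)"] by simp
    qed
    then show ?thesis by auto
  qed
  moreover have "card PP = p + p'" "card NN = q + q'"
    unfolding PP_def NN_def
    using PN(1,2,4,5) PN'(1,2,4,5) nz
    by (subst card_Un_disjoint; auto simp: card_cartesian_product)+
  moreover have "finite PP" "finite NN" "PP \<inter> NN = {}"
    using PN(1-3) PN'(1-3) nz by (auto simp: PP_def NN_def)
  ultimately show ?thesis
    using diag orth unfolding has_signature_def F_def[symmetric]
    by (intro exI[of _ PP] exI[of _ NN] conjI)
qed

section \<open>Bilinear forms of square matrices\<close>

lemma bilinear_inner_matrix: "bilinear (\<lambda>v w. v \<bullet> (A *v w))" for A :: "real^'m^'m"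
  unfolding bilinear_def
  by (auto intro!: linearI simp: inner_add_left inner_add_right matrix_vector_right_distrib
      matrix_vector_mult_scaleR)

lemma inner_matrix_transpose: "v \<bullet> (transpose A *v w) = w \<bullet> (A *v v)" for A :: "real^'m^'m"
  by (metis dot_lmul_matrix inner_commute transpose_matrix_vector)

text \<open>Orthogonality of a basis in both argument orders already forces the form to be symmetric, so
  the equality of mixed partial derivatives is not needed for the symmetry of \<open>g\<^sup>a\<^sup>b\<close>.\<close>

lemma has_signature_imp_symmetric:
  fixes A :: "real^'m^'m"
  assumes "has_signature UNIV (\<lambda>v w. v \<bullet> (A *v w)) p q"
  shows "transpose A = A"
proof -
  obtain S where S: "span S = UNIV" "\<forall>u\<in>S. \<forall>w\<in>S. u \<noteq> w \<longrightarrow> u \<bullet> (A *v w) = 0"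
    using assms unfolding has_signature_def by blast
  have "v \<bullet> (transpose A *v w) = v \<bullet> (A *v w)" for v w
  proof (rule bilinear_eq[OF bilinear_inner_matrix[of "transpose A"] bilinear_inner_matrix[of A], of UNIV S UNIV S])
    fix x y assume "x \<in> S" "y \<in> S"
    \<comment> \<open>Transposing swaps the arguments: for distinct basis elements both orders give
      0, and for equal ones they coincide.\<close>
    then show "x \<bullet> (transpose A *v y) = x \<bullet> (A *v y)"
      using S(2) unfolding inner_matrix_transpose by (cases "x = y") auto
  qed (auto simp: S(1))
  then have "transpose A *v w = A *v w" for w
    by (metis vector_eq_ldot)
  then show ?thesis
    by (simp add: matrix_eq)
qed

text \<open>Transposing \<open>A ** matrix_inv A = mat 1\<close> exhibits the transposed inverse as
  a left inverse of \<open>A\<close>, and a left inverse coincides with a right inverse.\<close>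

lemma transpose_matrix_inv:
  fixes A :: "real^'m^'m"
  assumes "invertible A" "transpose A = A"
  shows "transpose (matrix_inv A) = matrix_inv A"
proof -
  have "transpose (matrix_inv A) ** A = mat 1"
    by (metis assms matrix_inv_works(1) matrix_transpose_mul transpose_mat)
  then show ?thesis
    by (metis assms(1) matrix_inv_works(1) matrix_mul_assoc matrix_mul_lid matrix_mul_rid)
qed

text \<open>The map \<open>w \<mapsto> A w\<close> is an isometry from the form of \<open>A\<close> to the form of its inverse.\<close>

lemma has_signature_matrix_inv:
  fixes A :: "real^'m^'m"
  assumes "invertible A" "has_signature UNIV (\<lambda>v w. v \<bullet> (A *v w)) p q"
  shows "has_signature UNIV (\<lambda>v w. v \<bullet> (matrix_inv A *v w)) p q"
proof -
  \<comment> \<open>\<open>matrix_inv A\<close> cancels against the \<open>A\<close> next to it, and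
    the symmetry of \<open>A\<close> moves the other factor across the inner product.\<close>
  have "(A *v x) \<bullet> (matrix_inv A *v (A *v y)) = x \<bullet> (A *v y)" for x y
    using inner_matrix_transpose[of y A x]
    by (simp add: matrix_vector_mul_assoc matrix_inv_works(2)[OF assms(1)]
        has_signature_imp_symmetric[OF assms(2)] inner_commute)
  then have "has_signature (range ((*v) A)) (\<lambda>v w. v \<bullet> (matrix_inv A *v w)) p q"
    by (rule has_signature_linear_image[OF matrix_vector_mul_linear
          inj_matrix_vector_mult[OF assms(1)] assms(2)])
  moreover have "range ((*v) A) = UNIV"
    by (metis assms(1) matrix_inv_works(1) matrix_vector_mul_assoc matrix_vector_mul_lid surjI)
  ultimately show ?thesis by simp
qed

section \<open>Finite indexed families as bases\<close>

lemma independent_family: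
  fixes B :: "'k::finite \<Rightarrow> 'w::real_vector"
  assumes B: "\<And>u k. (\<Sum>k\<in>UNIV. u k *\<^sub>R B k) = 0 \<Longrightarrow> u k = 0"
  shows "inj B" "independent (range B)"
proof -
  show inj: "inj B"
  proof (rule injI, rule ccontr)
    fix i j assume ij: "B i = B j" "i \<noteq> j"
    \<comment> \<open>Equal values at \<open>i\<close> and \<open>j\<close> give a nontrivial
      relation with coefficients 1 and -1, which the set \<open>range B\<close> could not
      record.\<close>
    have "(\<Sum>k\<in>UNIV. ((if k = i then 1 else 0) - (if k = j then 1 else 0)) *\<^sub>R B k) = 0"
      using ij(1) by (simp add: scaleR_left_diff_distrib sum_subtractf if_distrib[of "\<lambda>r. r *\<^sub>R _"] cong: if_cong)
    from B[OF this, of i] ij(2) show False by simp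
  qed
  show "independent (range B)"
  proof (rule real_vector.independent_if_scalars_zero)
    fix g x assume "(\<Sum>x\<in>range B. g x *\<^sub>R x) = 0" "x \<in> range B"
    then show "g x = 0"
      using B[of "\<lambda>k. g (B k)"] by (auto simp: sum.reindex[OF inj])
  qed simp
qed

lemma representation_family:
  fixes B :: "'k::finite \<Rightarrow> 'w::real_vector"
  assumes inj: "inj B" and ind: "independent (range B)"
  shows "representation (range B) (\<Sum>k\<in>UNIV. u k *\<^sub>R B k) (B k) = u k"
proof -
  have "representation (range B) (\<Sum>k\<in>UNIV. u k *\<^sub>R B k) (B k)
      = (\<Sum>j\<in>UNIV. u j * (if B k = B j then 1 else 0))"
    by (simp add: real_vector.representation_sum[OF ind] real_vector.representation_scale[OF ind]
        real_vector.representation_basis[OF ind] real_vector.span_base real_vector.span_scale)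
  also have "\<dots> = u k"
    by (simp add: inj_eq[OF inj] if_distrib[of "(*) _"] cong: if_cong)
  finally show ?thesis .
qed

section \<open>Tangent vectors in charts\<close>

text \<open>What calculation with tangent vectors requires of an atlas. There is no topology on the
  underlying type and no covering condition: the charts of E^* cover only
  \<open>dual_bundle A\<close> inside its type.\<close>

definition differentiable_atlas :: "('q, 'b::real_normed_vector) chart set \<Rightarrow> bool" where
  "differentiable_atlas \<A> \<longleftrightarrow> (\<forall>c\<in>\<A>. inj_on (snd c) (fst c)) \<and>
     (\<forall>c\<in>\<A>. \<forall>d\<in>\<A>. open (snd c ` (fst c \<inter> fst d)) \<and>
        (\<forall>q\<in>fst c \<inter> fst d. in_chart c (snd d) differentiable (at (snd c q))))"

lemma in_chart_chart:
  assumes "inj_on (snd c) (fst c)" "q \<in> fst c"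
  shows "in_chart c F (snd c q) = F q"
  using assms by (simp add: in_chart_def)

text \<open>Near the point, \<open>F\<close> in the chart \<open>c\<close> is \<open>F\<close> in
  \<open>d\<close> after the transition map, so this is the chain rule. With
  \<open>F = snd e\<close> it is the cocycle rule behind tangent vectors; with a map into another
  manifold it makes tangent maps independent of charts.\<close>

lemma has_derivative_in_chart_change:
  assumes \<A>: "differentiable_atlas \<A>" "c \<in> \<A>" "d \<in> \<A>" and q: "q \<in> fst c" "q \<in> fst d"
    and F: "in_chart d F differentiable (at (snd d q))"
  shows "(in_chart c F has_derivative (\<lambda>v. frechet_derivative (in_chart d F) (at (snd d q))
      (frechet_derivative (in_chart c (snd d)) (at (snd c q)) v))) (at (snd c q))"
proof -
  have inj: "inj_on (snd c) (fst c)" "inj_on (snd d) (fst d)"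
    and op: "open (snd c ` (fst c \<inter> fst d))"
    and diff: "in_chart c (snd d) differentiable (at (snd c q))"
    using \<A> q unfolding differentiable_atlas_def by auto
  have c: "(in_chart c (snd d) has_derivative frechet_derivative (in_chart c (snd d)) (at (snd c q)))
      (at (snd c q))"
    using diff by (simp flip: frechet_derivative_works)
  have d: "(in_chart d F has_derivative frechet_derivative (in_chart d F) (at (snd d q)))
      (at (in_chart c (snd d) (snd c q)))"
    unfolding in_chart_chart[OF inj(1) q(1)] using F by (simp flip: frechet_derivative_works)
  show ?thesis
  proof (rule has_derivative_transform_within_open[OF has_derivative_compose[OF c d] op])
    show "snd c q \<in> snd c ` (fst c \<inter> fst d)" using q by blast
    show "in_chart d F (in_chart c (snd d) y) = in_chart c F y" if "y \<in> snd c ` (fst c \<inter> fst d)" for y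
      using that by (auto simp: in_chart_chart[OF inj(1)] in_chart_chart[OF inj(2)])
  qed
qed

lemma has_derivative_in_chart_self:
  assumes \<A>: "differentiable_atlas \<A>" "c \<in> \<A>" "q \<in> fst c"
  shows "(in_chart c (snd c) has_derivative (\<lambda>v. v)) (at (snd c q))"
proof (rule has_derivative_transform_within_open[OF has_derivative_ident])
  have "open (snd c ` (fst c \<inter> fst c))"
    using \<A> unfolding differentiable_atlas_def by blast
  then show "open (snd c ` fst c)" by simp
  have "inj_on (snd c) (fst c)"
    using \<A> unfolding differentiable_atlas_def by blast
  then show "y = in_chart c (snd c) y" if "y \<in> snd c ` fst c" for y
    using that by (auto simp: in_chart_chart)
qed (use assms in blast)

lemma coord_vector_self:
  "differentiable_atlas \<A> \<Longrightarrow> c \<in> \<A> \<Longrightarrow> q \<in> fst c \<Longrightarrow> coord_vector \<A> c q v c = v"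
  by (simp add: coord_vector_def frechet_derivative_eqI[OF has_derivative_in_chart_self])

lemma coord_vector_in_tangent_space:
  assumes \<A>: "differentiable_atlas \<A>" "c \<in> \<A>" "q \<in> fst c"
  shows "coord_vector \<A> c q v \<in> tangent_space \<A> q"
  unfolding tangent_space_def mem_Collect_eq
proof (intro conjI allI impI ballI)
  fix d e assume de: "d \<in> \<A>" "e \<in> \<A>" "q \<in> fst d \<inter> fst e"
  then have "in_chart d (snd e) differentiable (at (snd d q))"
    using \<A>(1) unfolding differentiable_atlas_def by blast
  from frechet_derivative_eqI[OF has_derivative_in_chart_change[OF \<A>(1,2) de(1) \<A>(3) _ this]] de
  show "coord_vector \<A> c q v e = frechet_derivative (in_chart d (snd e)) (at (snd d q)) (coord_vector \<A> c q v d)"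
    by (simp add: coord_vector_def)
qed (auto simp: coord_vector_def)

text \<open>Compatibility determines every coordinate vector from the one in \<open>c\<close>, and
  the default value 0 settles the remaining arguments.\<close>

lemma tangent_space_eq_coord_vector:
  assumes "w \<in> tangent_space \<A> q" "c \<in> \<A>" "q \<in> fst c"
  shows "w = coord_vector \<A> c q (w c)"
proof
  fix d
  have "w d = (if d \<in> \<A> \<and> q \<in> fst d
     then frechet_derivative (in_chart c (snd d)) (at (snd c q)) (w c) else 0)"
    using assms unfolding tangent_space_def mem_Collect_eq by (metis IntI)
  then show "w d = coord_vector \<A> c q (w c) d"
    by (simp only: coord_vector_def)
qed

lemma linear_coord_vector:
  assumes \<A>: "differentiable_atlas \<A>" "c \<in> \<A>" "q \<in> fst c"
  shows "linear (coord_vector \<A> c q)"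
proof -
  have "linear (frechet_derivative (in_chart c (snd d)) (at (snd c q)))" if "d \<in> \<A>" "q \<in> fst d" for d
    by (rule linear_frechet_derivative) (use \<A> that in \<open>auto simp: differentiable_atlas_def\<close>)
  then show ?thesis
    by (intro linearI) (auto simp: coord_vector_def fun_eq_iff scaleR_fun_def linear_add linear_scale)
qed

text \<open>\<open>tangent_map\<close> is computed in the chart picked by \<open>chart_at\<close>.
  The chain rule removes this choice, so that a chart adapted to the problem can be used
  instead.\<close>

lemma tangent_map_eq:
  assumes \<A>: "differentiable_atlas \<A>" "c \<in> \<A>" "q \<in> fst c" and w: "w \<in> tangent_space \<A> q"
    and F: "\<And>c d. c \<in> \<A> \<Longrightarrow> q \<in> fst c \<Longrightarrow> d \<in> \<B> \<Longrightarrow> F q \<in> fst d \<Longrightarrow>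
      in_chart c (snd d \<circ> F) differentiable (at (snd c q))"
  shows "tangent_map \<A> \<B> F q w = (\<lambda>d. if d \<in> \<B> \<and> F q \<in> fst d
     then frechet_derivative (in_chart c (snd d \<circ> F)) (at (snd c q)) (w c) else 0)"
proof -
  define e where "e = chart_at \<A> q"
  have e: "e \<in> \<A>" "q \<in> fst e"
    using someI[of "\<lambda>c. c \<in> \<A> \<and> q \<in> fst c" c] \<A> unfolding e_def chart_at_def by auto
  have we: "w e = frechet_derivative (in_chart c (snd e)) (at (snd c q)) (w c)"
    using w \<A> e unfolding tangent_space_def by blast
  have "frechet_derivative (in_chart c (snd d \<circ> F)) (at (snd c q)) (w c)
      = frechet_derivative (in_chart e (snd d \<circ> F)) (at (snd e q)) (w e)"
    if "d \<in> \<B>" "F q \<in> fst d" for d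
    unfolding we
    using frechet_derivative_eqI[OF has_derivative_in_chart_change[OF \<A>(1,2) e(1) \<A>(3) e(2) F[OF e that]]]
    by simp
  then show ?thesis
    by (auto simp: tangent_map_def Let_def fun_eq_iff simp flip: e_def)
qed

lemma smooth_atlas_open_image:
  assumes "smooth_atlas \<A>" "c \<in> \<A>" "open W"
  shows "open (snd c ` (fst c \<inter> W))"
proof -
  have c: "open (fst c)" "open (snd c ` fst c)"
    "homeomorphism (fst c) (snd c ` fst c) (snd c) (inv_into (fst c) (snd c))"
    using assms unfolding smooth_atlas_def by auto
  have "openin (top_of_set (fst c)) (fst c \<inter> W)"
    using assms(3) by (simp add: openin_open_Int)
  from homeomorphism_imp_open_map[OF c(3) this] c(2) show ?thesis
    by (rule openin_open_trans)
qed

lemma smooth_atlas_inj_on: "smooth_atlas \<A> \<Longrightarrow> c \<in> \<A> \<Longrightarrow> inj_on (snd c) (fst c)"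
  unfolding smooth_atlas_def homeomorphism_def by (auto intro!: inj_on_inverseI[of _ "inv_into (fst c) (snd c)"])

lemma smooth_atlas_imp_differentiable_atlas:
  assumes "smooth_atlas \<A>"
  shows "differentiable_atlas \<A>"
  unfolding differentiable_atlas_def
proof (intro conjI ballI)
  fix c d assume cd: "c \<in> \<A>" "d \<in> \<A>"
  show "inj_on (snd c) (fst c)" using smooth_atlas_inj_on[OF assms cd(1)] .
  show "open (snd c ` (fst c \<inter> fst d))"
    using smooth_atlas_open_image[OF assms cd(1)] assms cd(2) unfolding smooth_atlas_def by blast
  fix q assume "q \<in> fst c \<inter> fst d"
  moreover have "smooth_on (snd c ` (fst c \<inter> fst d)) (in_chart c (snd d))"
    using assms cd unfolding smooth_atlas_def by blast
  ultimately show "in_chart c (snd d) differentiable (at (snd c q))"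
    using smooth_on_imp_differentiable by blast
qed

section \<open>The dual bundle\<close>

lemma vector_bundleD:
  assumes "vector_bundle A"
  shows "smooth_atlas (charts A)" "subspace (fibre A x)"
    "f \<in> frames A \<Longrightarrow> open (fst f)"
    "f \<in> frames A \<Longrightarrow> x \<in> fst f \<Longrightarrow> inj (snd f x)"
    "f \<in> frames A \<Longrightarrow> x \<in> fst f \<Longrightarrow> independent (range (snd f x))"
    "f \<in> frames A \<Longrightarrow> x \<in> fst f \<Longrightarrow> span (range (snd f x)) = fibre A x"
    "f \<in> frames A \<Longrightarrow> smooth_section A (fst f) (\<lambda>x. snd f x a)"
  using assms unfolding vector_bundle_def by blast+

lemma frame_in_fibre:
  "vector_bundle A \<Longrightarrow> f \<in> frames A \<Longrightarrow> x \<in> fst f \<Longrightarrow> snd f x a \<in> fibre A x"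
  using vector_bundleD(6)[of A f x] span_base[of "snd f x a" "range (snd f x)"] by simp

lemma frame_expansion:
  assumes A: "vector_bundle A" "f \<in> frames A" "x \<in> fst f" and u: "u \<in> fibre A x"
  shows "u = (\<Sum>a\<in>UNIV. (frame_coord f x u $ a) *\<^sub>R snd f x a)"
proof -
  note B = vector_bundleD(4-6)[OF A]
  have "u = (\<Sum>b\<in>range (snd f x). representation (range (snd f x)) u b *\<^sub>R b)"
    using real_vector.sum_representation_eq[OF B(2), of u "range (snd f x)"] u B(3) by simp
  also have "\<dots> = (\<Sum>a\<in>UNIV. (frame_coord f x u $ a) *\<^sub>R snd f x a)"
    by (simp add: sum.reindex[OF B(1)] frame_coord_def)
  finally show ?thesis .
qed

lemma frame_coord_sum:
  assumes "vector_bundle A" "f \<in> frames A" "x \<in> fst f"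
  shows "frame_coord f x (\<Sum>a\<in>UNIV. u a *\<^sub>R snd f x a) = (\<chi> a. u a)"
  by (simp add: frame_coord_def representation_family vector_bundleD(4,5)[OF assms])

text \<open>Covectors and the anchor are additive and homogeneous on the fibres alone, so linearity
  has to be relative to a subspace \<open>V\<close>.\<close>

lemma subspace_linear_sum:
  fixes F :: "'v::real_vector \<Rightarrow> 'w::real_vector" and I :: "'i::finite set"
  assumes V: "subspace V" and add: "\<And>u w. u \<in> V \<Longrightarrow> w \<in> V \<Longrightarrow> F (u + w) = F u + F w"
    and scale: "\<And>s u. u \<in> V \<Longrightarrow> F (s *\<^sub>R u) = s *\<^sub>R F u" and v: "\<And>i. v i \<in> V"
  shows "F (\<Sum>i\<in>I. r i *\<^sub>R v i) = (\<Sum>i\<in>I. r i *\<^sub>R F (v i))"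
proof -
  have mem: "(\<Sum>i\<in>J. r i *\<^sub>R v i) \<in> V" for J
    by (intro subspace_sum subspace_scale V v)
  have "finite I" by simp
  then show ?thesis
  proof induction
    case empty
    then show ?case using scale[OF subspace_0[OF V], of 0] by simp
  next
    case (insert j J)
    then show ?case
      by (simp add: add[OF subspace_scale[OF V v] mem] scale[OF v])
  qed
qed

lemma dual_fibre_frame:
  assumes A: "vector_bundle A" "f \<in> frames A" "x \<in> fst f" and "\<alpha> \<in> dual_fibre A x" "u \<in> fibre A x"
  shows "\<alpha> u = (\<Sum>a\<in>UNIV. frame_coord f x u $ a * \<alpha> (snd f x a))"
  using arg_cong[OF frame_expansion[OF A assms(5)], of \<alpha>]
    assms(4) subspace_linear_sum[OF vector_bundleD(2)[OF A(1)] _ _ frame_in_fibre[OF A], of \<alpha>]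
  by (simp add: dual_fibre_def)

text \<open>A covector is a function on all of \<open>'v\<close>; its default value 0 outside the
  fibre is what lets agreement on a frame imply equality.\<close>

lemma dual_fibre_eqI:
  assumes A: "vector_bundle A" "f \<in> frames A" "x \<in> fst f" and "\<alpha> \<in> dual_fibre A x" "\<beta> \<in> dual_fibre A x"
    and eq: "\<And>a. \<alpha> (snd f x a) = \<beta> (snd f x a)"
  shows "\<alpha> = \<beta>"
proof
  fix u show "\<alpha> u = \<beta> u"
  proof (cases "u \<in> fibre A x")
    case True
    then show ?thesis
      by (simp only: dual_fibre_frame[OF A assms(4) True] dual_fibre_frame[OF A assms(5) True] eq)
  next
    case False
    then show ?thesis using assms(4,5) unfolding dual_fibre_def by simp
  qed
qed

text \<open>Every momentum vector occurs, which makes the image of a dual chart a full product with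
  R^m.\<close>

lemma ex_dual_fibre:
  assumes A: "vector_bundle A" "f \<in> frames A" "x \<in> fst f"
  obtains \<alpha> where "\<alpha> \<in> dual_fibre A x" "\<And>a. \<alpha> (snd f x a) = p a"
proof
  define \<alpha> where "\<alpha> u = (if u \<in> fibre A x then \<Sum>a\<in>UNIV. p a * frame_coord f x u $ a else 0)" for u
  note B = vector_bundleD(4-6)[OF A] and sub = vector_bundleD(2)[OF A(1), of x]
  have "frame_coord f x (u + w) = frame_coord f x u + frame_coord f x w"
    if "u \<in> fibre A x" "w \<in> fibre A x" for u w
    using that B(2,3) by (simp add: frame_coord_def vec_eq_iff real_vector.representation_add)
  moreover have "frame_coord f x (r *\<^sub>R u) = r *\<^sub>R frame_coord f x u" if "u \<in> fibre A x" for r u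
    using that B(2,3) by (simp add: frame_coord_def vec_eq_iff real_vector.representation_scale)
  ultimately show "\<alpha> \<in> dual_fibre A x"
    by (auto simp: dual_fibre_def \<alpha>_def subspace_add[OF sub] subspace_scale[OF sub] algebra_simps
        sum.distrib sum_distrib_left)
  show "\<alpha> (snd f x a) = p a" for a
  proof -
    have "frame_coord f x (snd f x a) $ b = (if b = a then 1 else 0)" for b
      using B by (auto simp: frame_coord_def real_vector.representation_basis inj_eq)
    then show ?thesis
      by (simp add: \<alpha>_def frame_in_fibre[OF A] if_distrib[of "(*) _"] cong: if_cong)
  qed
qed

lemma fst_dual_chart: "fst (dual_chart A c f) = {\<mu> \<in> dual_bundle A. fst \<mu> \<in> fst c \<inter> fst f}"
  by (simp add: dual_chart_def)

lemma snd_dual_chart: "snd (dual_chart A c f) (x, \<alpha>) = (snd c x, \<chi> a. \<alpha> (snd f x a))"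
  by (simp add: dual_chart_def)

text \<open>Domains of dual charts and their overlaps are cylinders over sets \<open>W\<close> of
  the base. Their images are products, so openness is inherited from the base chart.\<close>

lemma dual_chart_image:
  assumes A: "vector_bundle A" "f \<in> frames A"
  shows "snd (dual_chart A c f) ` (fst (dual_chart A c f) \<inter> {\<mu>. fst \<mu> \<in> W}) =
    (snd c ` (fst c \<inter> (fst f \<inter> W))) \<times> UNIV" (is "_ = ?R")
proof (intro equalityI subsetI)
  fix y assume "y \<in> ?R"
  then obtain x p where x: "x \<in> fst c" "x \<in> fst f" "x \<in> W" and y: "y = (snd c x, p)"
    by auto
  obtain \<alpha> where \<alpha>: "\<alpha> \<in> dual_fibre A x" "\<And>a. \<alpha> (snd f x a) = p $ a"
    using ex_dual_fibre[OF A x(2), of "\<lambda>a. p $ a"] by blast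
  have "y = snd (dual_chart A c f) (x, \<alpha>)"
    by (simp add: snd_dual_chart y \<alpha>(2))
  moreover have "(x, \<alpha>) \<in> fst (dual_chart A c f) \<inter> {\<mu>. fst \<mu> \<in> W}"
    using x \<alpha>(1) by (simp add: fst_dual_chart dual_bundle_def)
  ultimately show "y \<in> snd (dual_chart A c f) ` (fst (dual_chart A c f) \<inter> {\<mu>. fst \<mu> \<in> W})"
    by blast
qed (auto simp: fst_dual_chart snd_dual_chart)

lemma inj_on_dual_chart:
  assumes A: "vector_bundle A" "f \<in> frames A" and c: "c \<in> charts A"
  shows "inj_on (snd (dual_chart A c f)) (fst (dual_chart A c f))"
proof (rule inj_onI)
  fix \<mu> \<nu> assume *: "\<mu> \<in> fst (dual_chart A c f)" "\<nu> \<in> fst (dual_chart A c f)"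
    "snd (dual_chart A c f) \<mu> = snd (dual_chart A c f) \<nu>"
  obtain x \<alpha> y \<beta> where \<mu>: "\<mu> = (x, \<alpha>)" and \<nu>: "\<nu> = (y, \<beta>)" by fastforce
  have m: "x \<in> fst c" "x \<in> fst f" "y \<in> fst c" "\<alpha> \<in> dual_fibre A x" "\<beta> \<in> dual_fibre A y"
    using * by (auto simp: \<mu> \<nu> fst_dual_chart dual_bundle_def)
  have "x = y"
    using *(3) smooth_atlas_inj_on[OF vector_bundleD(1)[OF A(1)] c] m(1,3)
    by (auto simp: \<mu> \<nu> snd_dual_chart dest: inj_onD)
  moreover have "\<alpha> = \<beta>"
    by (rule dual_fibre_eqI[OF A m(2)]) (use m *(3) \<open>x = y\<close> in \<open>auto simp: \<mu> \<nu> snd_dual_chart vec_eq_iff\<close>)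
  ultimately show "\<mu> = \<nu>" by (simp add: \<mu> \<nu>)
qed

text \<open>The zero section is p = 0: a covector with vanishing momenta agrees with the zero
  covector on a frame.\<close>

lemma slit_dual_image:
  assumes A: "vector_bundle A" "f \<in> frames A"
  shows "snd (dual_chart A c f) ` (slit_dual A \<inter> fst (dual_chart A c f)) =
    (snd c ` (fst c \<inter> fst f)) \<times> (- {0})"
proof -
  let ?d = "dual_chart A c f"
  have "\<alpha> = 0 \<longleftrightarrow> (\<chi> a. \<alpha> (snd f x a)) = 0" if "(x, \<alpha>) \<in> fst ?d" for x \<alpha>
  proof
    assume "(\<chi> a. \<alpha> (snd f x a)) = 0"
    moreover have "x \<in> fst f" "\<alpha> \<in> dual_fibre A x" "0 \<in> dual_fibre A x"
      using that by (auto simp: fst_dual_chart dual_bundle_def dual_fibre_def)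
    ultimately show "\<alpha> = 0"
      by (intro dual_fibre_eqI[OF A]) (auto simp: vec_eq_iff)
  qed (simp add: vec_eq_iff)
  then have "slit_dual A \<inter> fst ?d = {\<mu> \<in> fst ?d. snd (snd ?d \<mu>) \<noteq> 0}"
    by (auto simp: slit_dual_def snd_dual_chart) (auto simp: fst_dual_chart)
  then have "snd ?d ` (slit_dual A \<inter> fst ?d) = snd ?d ` fst ?d \<inter> {y. snd y \<noteq> 0}"
    by auto
  also have "\<dots> = (snd c ` (fst c \<inter> fst f)) \<times> (- {0})"
    using dual_chart_image[OF A, of c UNIV] by auto
  finally show ?thesis .
qed

lemma open_slit_dual_image:
  assumes "vector_bundle A" "f \<in> frames A" "c \<in> charts A"
  shows "open (snd (dual_chart A c f) ` (slit_dual A \<inter> fst (dual_chart A c f)))"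
  unfolding slit_dual_image[OF assms(1,2)]
  by (intro open_Times smooth_atlas_open_image[OF vector_bundleD(1)[OF assms(1)] assms(3)]
      vector_bundleD(3)[OF assms(1,2)] open_Compl closed_singleton)

text \<open>The base coordinates change by the base transition map, and the new momenta are linear
  in the old ones with coefficients depending smoothly on x, because the members of one frame are
  smooth sections when expanded in the other.\<close>

lemma smooth_on_dual_transition:
  assumes A: "vector_bundle A" and c: "c \<in> charts A" "c' \<in> charts A"
    and f: "f \<in> frames A" "f' \<in> frames A"
  shows "smooth_on (snd (dual_chart A c f) ` (fst (dual_chart A c f) \<inter> fst (dual_chart A c' f')))
    (in_chart (dual_chart A c f) (snd (dual_chart A c' f')))"
    and "open (snd (dual_chart A c f) ` (fst (dual_chart A c f) \<inter> fst (dual_chart A c' f')))"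
proof -
  let ?d = "dual_chart A c f" and ?d' = "dual_chart A c' f'"
  let ?W = "fst c' \<inter> fst f'"
  define T where "T = snd ?d ` (fst ?d \<inter> fst ?d')"
  note sm = vector_bundleD(1)[OF A]
  have "fst ?d \<inter> fst ?d' = fst ?d \<inter> {\<mu>. fst \<mu> \<in> ?W}"
    by (auto simp: fst_dual_chart)
  then have T: "T = (snd c ` (fst c \<inter> (fst f \<inter> ?W))) \<times> UNIV"
    by (simp only: T_def dual_chart_image[OF A f(1)])
  have W: "open ?W"
    using sm c(2) vector_bundleD(3)[OF A f(2)] unfolding smooth_atlas_def by blast
  show "open (snd ?d ` (fst ?d \<inter> fst ?d'))"
    unfolding T_def[symmetric] T
    by (intro open_Times open_UNIV smooth_atlas_open_image[OF sm c(1)]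
        open_Int[OF vector_bundleD(3)[OF A f(1)] W])
  then have oT: "open T" by (simp only: T_def)
  \<comment> \<open>The matrix expressing the frame \<open>f'\<close> in the frame \<open>f\<close>;
    evaluating a covector on it gives the new momenta.\<close>
  define G where "G b a = in_chart c (\<lambda>x. frame_coord f x (snd f' x a) $ b)" for a b
  have "smooth_on T (\<lambda>w. in_chart c (snd c') (fst w))"
    by (rule smooth_on_compose_fst[OF oT, of "snd c ` (fst c \<inter> fst c')"])
      (use sm c in \<open>auto simp: T smooth_atlas_def\<close>)
  moreover have "smooth_on T (\<lambda>w. G b a (fst w))" for a b
  proof -
    have "smooth_on (snd c ` (fst f' \<inter> fst c \<inter> fst f)) (in_chart c (\<lambda>x. frame_coord f x (snd f' x a)))"
      using vector_bundleD(7)[OF A f(2), of a] c f unfolding smooth_section_def by blast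
    then have "smooth_on T (\<lambda>w. in_chart c (\<lambda>x. frame_coord f x (snd f' x a)) (fst w))"
      by (rule smooth_on_compose_fst[OF oT, rotated]) (auto simp: T)
    from smooth_on_vec_nth[OF oT this, of b] show ?thesis
      by (simp add: G_def in_chart_def)
  qed
  moreover have "smooth_on T (\<lambda>w. snd w $ b)" for b
    by (rule smooth_on_linear[OF _ oT]) (auto intro: bounded_linear_compose[OF bounded_linear_vec_nth] bounded_linear_snd)
  \<comment> \<open>The pair is written as a sum of embedded components, so that closure under sums,
    products and bounded linear maps suffices.\<close>
  ultimately have "smooth_on T (\<lambda>w. (in_chart c (snd c') (fst w), 0) +
      (\<Sum>a\<in>UNIV. (0, (\<Sum>b\<in>UNIV. G b a (fst w) * snd w $ b) *\<^sub>R axis a 1)))"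
    by (intro smooth_on_add smooth_on_sum smooth_on_mult oT
        smooth_on_bounded_linear[of "\<lambda>v. (v, 0)"] smooth_on_bounded_linear[of "\<lambda>r. (0, r *\<^sub>R axis _ 1)"])
      (auto intro!: bounded_linear_Pair bounded_linear_zero bounded_linear_ident bounded_linear_scaleR_left)
  then show "smooth_on (snd ?d ` (fst ?d \<inter> fst ?d')) (in_chart ?d (snd ?d'))"
    unfolding T_def[symmetric]
  proof (rule smooth_on_cong[OF oT])
    fix w assume "w \<in> T"
    then obtain x \<alpha> where \<mu>: "(x, \<alpha>) \<in> fst ?d" "(x, \<alpha>) \<in> fst ?d'" and w: "w = snd ?d (x, \<alpha>)"
      unfolding T_def by auto
    have x: "x \<in> fst c" "x \<in> fst f" "x \<in> fst f'" "\<alpha> \<in> dual_fibre A x"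
      using \<mu> by (auto simp: fst_dual_chart dual_bundle_def)
    have "\<alpha> (snd f' x a) = (\<Sum>b\<in>UNIV. G b a (snd c x) * \<alpha> (snd f x b))" for a
      using dual_fibre_frame[OF A f(1) x(2,4) frame_in_fibre[OF A f(2) x(3)], of a]
      by (simp add: G_def in_chart_chart[OF smooth_atlas_inj_on[OF sm c(1)] x(1)])
    then show "(in_chart c (snd c') (fst w), 0) +
      (\<Sum>a\<in>UNIV. (0, (\<Sum>b\<in>UNIV. G b a (fst w) * snd w $ b) *\<^sub>R axis a 1)) = in_chart ?d (snd ?d') w"
      unfolding w in_chart_chart[OF inj_on_dual_chart[OF A f(1) c(1)] \<mu>(1)]
      by (simp add: snd_dual_chart in_chart_chart[OF smooth_atlas_inj_on[OF sm c(1)] x(1)]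
          prod_eq_iff fst_sum snd_sum vec_eq_iff axis_def if_distrib[of "(*) _"] cong: if_cong)
  qed
qed

lemma differentiable_dual_charts:
  assumes "vector_bundle A"
  shows "differentiable_atlas (dual_charts A)"
  unfolding differentiable_atlas_def
proof (intro conjI ballI)
  fix d d' assume "d \<in> dual_charts A" "d' \<in> dual_charts A"
  then obtain c f c' f' where d: "d = dual_chart A c f" "d' = dual_chart A c' f'"
    and cf: "c \<in> charts A" "c' \<in> charts A" "f \<in> frames A" "f' \<in> frames A"
    unfolding dual_charts_def by blast
  show "inj_on (snd d) (fst d)"
    unfolding d by (rule inj_on_dual_chart[OF assms cf(3,1)])
  show "open (snd d ` (fst d \<inter> fst d'))"
    unfolding d by (rule smooth_on_dual_transition(2)[OF assms cf])
  show "in_chart d (snd d') differentiable (at (snd d \<mu>))" if "\<mu> \<in> fst d \<inter> fst d'" for \<mu>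
    using that smooth_on_imp_differentiable[OF smooth_on_dual_transition(1)[OF assms cf]]
    unfolding d by blast
qed

section \<open>The prolongation\<close>

text \<open>In the bundle chart over \<open>c\<close> the projection reads as \<open>fst\<close>
  followed by the transition from \<open>c\<close> to \<open>e\<close>.\<close>

lemma has_derivative_dual_proj:
  assumes A: "vector_bundle A" and c: "c \<in> charts A" and f: "f \<in> frames A" and e: "e \<in> charts A"
    and \<mu>: "\<mu> \<in> fst (dual_chart A c f)" "fst \<mu> \<in> fst e"
  shows "(in_chart (dual_chart A c f) (snd e \<circ> fst) has_derivative
      (\<lambda>w. frechet_derivative (in_chart c (snd e)) (at (snd c (fst \<mu>))) (fst w)))
    (at (snd (dual_chart A c f) \<mu>))"
proof -
  let ?d = "dual_chart A c f"
  note sm = vector_bundleD(1)[OF A]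
  have x: "fst \<mu> \<in> fst c" using \<mu>(1) by (simp add: fst_dual_chart)
  have fd: "fst (snd ?d \<nu>) = snd c (fst \<nu>)" for \<nu>
    by (simp add: dual_chart_def)
  have "in_chart c (snd e) differentiable (at (snd c (fst \<mu>)))"
    using smooth_atlas_imp_differentiable_atlas[OF sm] c e x \<mu>(2) unfolding differentiable_atlas_def by auto
  then have D: "(in_chart c (snd e) has_derivative frechet_derivative (in_chart c (snd e)) (at (snd c (fst \<mu>))))
      (at (fst (snd ?d \<mu>)))"
    unfolding fd by (simp flip: frechet_derivative_works)
  have op: "open (snd ?d ` fst ?d)"
    using smooth_on_dual_transition(2)[OF A c c f f] by simp
  show ?thesis
  proof (rule has_derivative_transform_within_open[OF
        has_derivative_compose[OF has_derivative_fst[OF has_derivative_ident] D] op])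
    show "in_chart c (snd e) (fst y) = in_chart ?d (snd e \<circ> fst) y" if y: "y \<in> snd ?d ` fst ?d" for y
    proof -
      obtain \<nu> where \<nu>: "\<nu> \<in> fst ?d" "y = snd ?d \<nu>" using y by blast
      have "fst \<nu> \<in> fst c" using \<nu>(1) by (simp add: fst_dual_chart)
      then show ?thesis
        by (simp add: \<nu>(2) fd in_chart_chart[OF inj_on_dual_chart[OF A f c] \<nu>(1)]
            in_chart_chart[OF smooth_atlas_inj_on[OF sm c]])
    qed
  qed (use \<mu>(1) in blast)
qed

lemma tangent_map_dual_proj:
  assumes A: "vector_bundle A" and c: "c \<in> charts A" and f: "f \<in> frames A"
    and \<mu>: "\<mu> \<in> fst (dual_chart A c f)" and z: "z \<in> tangent_space (dual_charts A) \<mu>"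
  shows "tangent_map (dual_charts A) (charts A) fst \<mu> z
    = coord_vector (charts A) c (fst \<mu>) (fst (z (dual_chart A c f)))"
proof -
  have d: "dual_chart A c f \<in> dual_charts A"
    unfolding dual_charts_def using c f by blast
  have "in_chart d (snd e \<circ> fst) differentiable (at (snd d \<mu>))"
    if "d \<in> dual_charts A" "\<mu> \<in> fst d" "e \<in> charts A" "fst \<mu> \<in> fst e" for d e
  proof -
    obtain c' f' where d': "d = dual_chart A c' f'" "c' \<in> charts A" "f' \<in> frames A"
      using \<open>d \<in> dual_charts A\<close> unfolding dual_charts_def by blast
    show ?thesis
      unfolding d'(1)
      by (rule differentiableI[OF has_derivative_dual_proj[OF A d'(2,3) that(3) that(2)[unfolded d'(1)] that(4)]])
  qed
  then have T: "tangent_map (dual_charts A) (charts A) fst \<mu> z = (\<lambda>e. if e \<in> charts A \<and> fst \<mu> \<in> fst e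
     then frechet_derivative (in_chart (dual_chart A c f) (snd e \<circ> fst)) (at (snd (dual_chart A c f) \<mu>))
       (z (dual_chart A c f)) else 0)"
    by (intro tangent_map_eq[OF differentiable_dual_charts[OF A] d \<mu> z])
  show ?thesis
  proof
    fix e
    show "tangent_map (dual_charts A) (charts A) fst \<mu> z e
      = coord_vector (charts A) c (fst \<mu>) (fst (z (dual_chart A c f))) e"
    proof (cases "e \<in> charts A \<and> fst \<mu> \<in> fst e")
      case True
      then show ?thesis
        unfolding T coord_vector_def
        by (simp add: frechet_derivative_eqI[OF has_derivative_dual_proj[OF A c f _ \<mu>]])
    next
      case False
      then show ?thesis
        unfolding T coord_vector_def by (simp only: if_False)
    qed
  qed
qed

text \<open>The tangent map of the projection keeps the x-components of \<open>z\<close>, so the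
  prolongation condition prescribes them by the anchor of \<open>b\<close>. The p-components \<pi>
  remain arbitrary, which gives 2m free parameters.\<close>

lemma prolongation_eq:
  assumes A: "vector_bundle A" "smooth_anchor A" and c: "c \<in> charts A" and f: "f \<in> frames A"
    and \<mu>: "\<mu> \<in> fst (dual_chart A c f)"
  shows "prolongation A \<mu> = {(b, coord_vector (dual_charts A) (dual_chart A c f) \<mu>
      (anchor A (fst \<mu>) b c, \<pi>)) | b \<pi>. b \<in> fibre A (fst \<mu>)}" (is "_ = ?R")
proof -
  let ?d = "dual_chart A c f"
  have d: "?d \<in> dual_charts A"
    unfolding dual_charts_def using c f by blast
  have x: "fst \<mu> \<in> fst c" using \<mu> by (simp add: fst_dual_chart)
  note at = smooth_atlas_imp_differentiable_atlas[OF vector_bundleD(1)[OF A(1)]]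
    and dat = differentiable_dual_charts[OF A(1)]
  have anchor: "anchor A (fst \<mu>) b = coord_vector (charts A) c (fst \<mu>) (anchor A (fst \<mu>) b c)"
    if "b \<in> fibre A (fst \<mu>)" for b
    by (rule tangent_space_eq_coord_vector[OF _ c x]) (use A(2) that in \<open>simp add: smooth_anchor_def\<close>)
  show ?thesis
  proof (intro equalityI subsetI)
    fix X assume "X \<in> prolongation A \<mu>"
    then obtain b z where X: "X = (b, z)" and b: "b \<in> fibre A (fst \<mu>)"
      and z: "z \<in> tangent_space (dual_charts A) \<mu>"
      and eq: "anchor A (fst \<mu>) b = tangent_map (dual_charts A) (charts A) fst \<mu> z"
      unfolding prolongation_def by blast
    have "anchor A (fst \<mu>) b c = fst (z ?d)"
      unfolding eq tangent_map_dual_proj[OF A(1) c f \<mu> z] by (rule coord_vector_self[OF at c x])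
    then have "z = coord_vector (dual_charts A) ?d \<mu> (anchor A (fst \<mu>) b c, snd (z ?d))"
      using tangent_space_eq_coord_vector[OF z d \<mu>] by simp
    with X b show "X \<in> ?R" by blast
  next
    fix X assume "X \<in> ?R"
    then obtain b \<pi> where X: "X = (b, coord_vector (dual_charts A) ?d \<mu> (anchor A (fst \<mu>) b c, \<pi>))"
      and b: "b \<in> fibre A (fst \<mu>)" by blast
    have z: "coord_vector (dual_charts A) ?d \<mu> (anchor A (fst \<mu>) b c, \<pi>) \<in> tangent_space (dual_charts A) \<mu>"
      by (rule coord_vector_in_tangent_space[OF dat d \<mu>])
    show "X \<in> prolongation A \<mu>"
      unfolding prolongation_def X
      using z b anchor[OF b] tangent_map_dual_proj[OF A(1) c f \<mu> z] coord_vector_self[OF dat d \<mu>]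
      by simp
  qed
qed

lemma anchor_sum:
  assumes A: "vector_bundle A" "smooth_anchor A" and "\<And>i. v i \<in> fibre A x"
  shows "anchor A x (\<Sum>i\<in>(UNIV::'i::finite set). r i *\<^sub>R v i) c = (\<Sum>i\<in>UNIV. r i *\<^sub>R anchor A x (v i) c)"
proof (rule subspace_linear_sum[where F = "\<lambda>u. anchor A x u c", OF vector_bundleD(2)[OF A(1)]])
  show "anchor A x (u + w) c = anchor A x u c + anchor A x w c"
    if "u \<in> fibre A x" "w \<in> fibre A x" for u w
  proof -
    have "anchor A x (u + w) = anchor A x u + anchor A x w"
      using A(2) that unfolding smooth_anchor_def by blast
    then show ?thesis by simp
  qed
  show "anchor A x (s *\<^sub>R u) c = s *\<^sub>R anchor A x u c" if "u \<in> fibre A x" for s u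
  proof -
    have "anchor A x (s *\<^sub>R u) = s *\<^sub>R anchor A x u"
      using A(2) that unfolding smooth_anchor_def by blast
    then show ?thesis by (simp add: scaleR_fun_def)
  qed
qed (rule assms(3))

lemma sum_UNIV_Plus:
  fixes F :: "'a::finite + 'b::finite \<Rightarrow> 'c::comm_monoid_add"
  shows "(\<Sum>k\<in>UNIV. F k) = (\<Sum>a\<in>UNIV. F (Inl a)) + (\<Sum>b\<in>UNIV. F (Inr b))"
  using sum.Plus[of UNIV UNIV F] by (simp add: UNIV_Plus_UNIV)

text \<open>Linearity gathers the coefficients: those at \<open>Inl\<close> form the component in E
  and, through the anchor, the x-components; those at \<open>Inr\<close> are the p-components.
  Independence and spanning are both read off from this normal form.\<close>

lemma sum_prol_basis:
  fixes A :: "('x::{t2_space,second_countable_topology}, 'v::real_vector, 'n::finite, 'm::finite) algebroid"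
  assumes A: "vector_bundle A" "smooth_anchor A" and c: "c \<in> charts A" and f: "f \<in> frames A"
    and \<mu>: "\<mu> \<in> fst (dual_chart A c f)"
  shows "(\<Sum>k\<in>UNIV. u k *\<^sub>R prol_basis A c f \<mu> k) =
    (\<Sum>a\<in>UNIV. u (Inl a) *\<^sub>R snd f (fst \<mu>) a,
     coord_vector (dual_charts A) (dual_chart A c f) \<mu>
       (anchor A (fst \<mu>) (\<Sum>a\<in>UNIV. u (Inl a) *\<^sub>R snd f (fst \<mu>) a) c, \<chi> a. u (Inr a)))"
proof -
  let ?L = "coord_vector (dual_charts A) (dual_chart A c f) \<mu>"
  have d: "dual_chart A c f \<in> dual_charts A"
    unfolding dual_charts_def using c f by blast
  have x: "fst \<mu> \<in> fst c" "fst \<mu> \<in> fst f" using \<mu> by (simp_all add: fst_dual_chart)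
  have rho: "(\<chi> i. rho A c f i a (fst (snd (dual_chart A c f) \<mu>))) = anchor A (fst \<mu>) (snd f (fst \<mu>) a) c" for a
    by (simp add: rho_def vec_eq_iff dual_chart_def
        in_chart_chart[OF smooth_atlas_inj_on[OF vector_bundleD(1)[OF A(1)] c] x(1)])
  have L: "linear ?L" by (rule linear_coord_vector[OF differentiable_dual_charts[OF A(1)] d \<mu>])
  have "(\<Sum>a\<in>UNIV. u (Inl a) *\<^sub>R ?L (anchor A (fst \<mu>) (snd f (fst \<mu>) a) c, 0))
      + (\<Sum>a\<in>UNIV. u (Inr a) *\<^sub>R ?L (0, axis a 1))
    = ?L ((\<Sum>a\<in>UNIV. u (Inl a) *\<^sub>R (anchor A (fst \<mu>) (snd f (fst \<mu>) a) c, 0))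
      + (\<Sum>a\<in>UNIV. u (Inr a) *\<^sub>R (0, axis a 1)))"
    by (simp only: linear_add[OF L] linear_sum[OF L] linear_scale[OF L])
  also have "(\<Sum>a\<in>UNIV. u (Inl a) *\<^sub>R (anchor A (fst \<mu>) (snd f (fst \<mu>) a) c, 0 :: real^'m))
      + (\<Sum>a\<in>UNIV. u (Inr a) *\<^sub>R (0, axis a 1))
    = (anchor A (fst \<mu>) (\<Sum>a\<in>UNIV. u (Inl a) *\<^sub>R snd f (fst \<mu>) a) c, \<chi> a. u (Inr a))"
    by (simp add: prod_eq_iff fst_sum snd_sum anchor_sum[OF A frame_in_fibre[OF A(1) f x(2)]]
        vec_eq_iff axis_def if_distrib[of "(*) _"] cong: if_cong)
  finally have "snd (\<Sum>k\<in>UNIV. u k *\<^sub>R prol_basis A c f \<mu> k) =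
    ?L (anchor A (fst \<mu>) (\<Sum>a\<in>UNIV. u (Inl a) *\<^sub>R snd f (fst \<mu>) a) c, \<chi> a. u (Inr a))"
    by (simp only: sum_UNIV_Plus snd_add snd_sum snd_scaleR prol_basis.simps snd_conv rho)
  moreover have "fst (\<Sum>k\<in>UNIV. u k *\<^sub>R prol_basis A c f \<mu> k) = (\<Sum>a\<in>UNIV. u (Inl a) *\<^sub>R snd f (fst \<mu>) a)"
    by (simp add: sum_UNIV_Plus fst_sum)
  ultimately show ?thesis
    by (simp only: prod_eq_iff fst_conv snd_conv)
qed

text \<open>The component in E forces the \<open>Inl\<close> coefficients to vanish, as the frame is
  independent; the tangent vector, read in its own chart, then shows only the \<open>Inr\<close>
  coefficients.\<close>

lemma prol_basis_kernel:
  assumes A: "vector_bundle A" "smooth_anchor A" and c: "c \<in> charts A" and f: "f \<in> frames A"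
    and \<mu>: "\<mu> \<in> fst (dual_chart A c f)"
    and 0: "(\<Sum>k\<in>UNIV. u k *\<^sub>R prol_basis A c f \<mu> k) = 0"
  shows "u k = 0"
proof -
  have d: "dual_chart A c f \<in> dual_charts A"
    unfolding dual_charts_def using c f by blast
  have x: "fst \<mu> \<in> fst f" using \<mu> by (simp add: fst_dual_chart)
  note eq = 0[unfolded sum_prol_basis[OF A c f \<mu>]]
  have e0: "(\<Sum>a\<in>UNIV. u (Inl a) *\<^sub>R snd f (fst \<mu>) a) = 0"
    using eq by (simp add: prod_eq_iff)
  have l: "u (Inl a) = 0" for a
    using frame_coord_sum[OF A(1) f x, of "\<lambda>a. u (Inl a)"]
    unfolding e0 by (simp add: frame_coord_def real_vector.representation_zero vec_eq_iff)
  have "coord_vector (dual_charts A) (dual_chart A c f) \<mu>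
       (anchor A (fst \<mu>) 0 c, \<chi> a. u (Inr a)) (dual_chart A c f) = 0"
    using eq unfolding e0 by (simp add: prod_eq_iff)
  then have "u (Inr a) = 0" for a
    unfolding coord_vector_self[OF differentiable_dual_charts[OF A(1)] d \<mu>]
    by (simp add: prod_eq_iff vec_eq_iff)
  with l show ?thesis by (cases k) auto
qed

lemma prolongation_eq_range:
  assumes A: "vector_bundle A" "smooth_anchor A" and c: "c \<in> charts A" and f: "f \<in> frames A"
    and \<mu>: "\<mu> \<in> fst (dual_chart A c f)"
  shows "prolongation A \<mu> = range (\<lambda>u. \<Sum>k\<in>UNIV. u k *\<^sub>R prol_basis A c f \<mu> k)"
  unfolding prolongation_eq[OF A c f \<mu>] sum_prol_basis[OF A c f \<mu>]
proof (intro equalityI subsetI)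
  let ?S = "\<lambda>u. \<Sum>a\<in>UNIV. u (Inl a) *\<^sub>R snd f (fst \<mu>) a"
  have x: "fst \<mu> \<in> fst f" using \<mu> by (simp add: fst_dual_chart)
  {
    fix X assume "X \<in> {(b, coord_vector (dual_charts A) (dual_chart A c f) \<mu>
      (anchor A (fst \<mu>) b c, \<pi>)) | b \<pi>. b \<in> fibre A (fst \<mu>)}"
    then obtain b \<pi> where X: "X = (b, coord_vector (dual_charts A) (dual_chart A c f) \<mu>
        (anchor A (fst \<mu>) b c, \<pi>))" and b: "b \<in> fibre A (fst \<mu>)" by blast
    define u where "u = case_sum (\<lambda>a. frame_coord f (fst \<mu>) b $ a) (\<lambda>a. \<pi> $ a)"
    have "?S u = b" "(\<chi> a. u (Inr a)) = \<pi>"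
      using frame_expansion[OF A(1) f x b] by (simp_all add: u_def)
    then show "X \<in> range (\<lambda>u. (?S u, coord_vector (dual_charts A) (dual_chart A c f) \<mu>
        (anchor A (fst \<mu>) (?S u) c, \<chi> a. u (Inr a))))"
      unfolding X by (intro range_eqI[of _ _ u]) simp
  next
    fix X assume "X \<in> range (\<lambda>u. (?S u, coord_vector (dual_charts A) (dual_chart A c f) \<mu>
        (anchor A (fst \<mu>) (?S u) c, \<chi> a. u (Inr a))))"
    moreover have "?S u \<in> fibre A (fst \<mu>)" for u
      by (intro subspace_sum subspace_scale vector_bundleD(2)[OF A(1)] frame_in_fibre[OF A(1) f x])
    ultimately show "X \<in> {(b, coord_vector (dual_charts A) (dual_chart A c f) \<mu>
      (anchor A (fst \<mu>) b c, \<pi>)) | b \<pi>. b \<in> fibre A (fst \<mu>)}"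
      by blast
  }
qed

lemma prol_cobasis_sum:
  assumes "vector_bundle A" "smooth_anchor A" "c \<in> charts A" "f \<in> frames A"
    and "\<mu> \<in> fst (dual_chart A c f)"
  shows "prol_cobasis A c f \<mu> k (\<Sum>j\<in>UNIV. u j *\<^sub>R prol_basis A c f \<mu> j) = u k"
proof -
  have K: "inj (prol_basis A c f \<mu>) \<and> independent (range (prol_basis A c f \<mu>))"
    using independent_family[of "prol_basis A c f \<mu>"] prol_basis_kernel[OF assms] by simp
  then show ?thesis
    unfolding prol_cobasis_def by (intro representation_family) auto
qed

lemma prol_cobasis_basis:
  assumes "vector_bundle A" "smooth_anchor A" "c \<in> charts A" "f \<in> frames A"
    and "\<mu> \<in> fst (dual_chart A c f)"
  shows "prol_cobasis A c f \<mu> k (prol_basis A c f \<mu> l) = (if k = l then 1 else 0)"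
  using prol_cobasis_sum[OF assms, of k "\<lambda>j. if j = l then 1 else 0"]
  by (simp add: if_distrib[of "\<lambda>r. r *\<^sub>R _"] cong: if_cong)

lemma inner_matrix_sum:
  "(\<Sum>a\<in>UNIV. \<Sum>b\<in>UNIV. M $ a $ b * v $ a * w $ b) = v \<bullet> (M *v w)" for M :: "real^'m^'m"
  by (simp add: inner_vec_def matrix_vector_mult_def sum_distrib_left algebra_simps)

text \<open>\<open>frame_map\<close> sends coordinates to the element of the prolongation with these coordinates
  in the coframe adapted to \<^term>\<open>N\<close>; the d-metric is block diagonal in these coordinates.\<close>

definition frame_map ::
  "('x, 'v::real_vector, 'n::finite, 'm::finite) algebroid \<Rightarrow> ('x, real^'n) chart \<Rightarrow> ('x, 'v, 'm) frame \<Rightarrow>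
   ('m \<Rightarrow> 'm \<Rightarrow> real) \<Rightarrow> 'x \<times> ('v \<Rightarrow> real) \<Rightarrow> (real^'m) \<times> (real^'m) \<Rightarrow> ('x, 'v, 'n, 'm) prol_vec" where
  "frame_map A c f N \<mu> s = (\<Sum>k\<in>UNIV. (case k of Inl a \<Rightarrow> fst s $ a
     | Inr a \<Rightarrow> snd s $ a - (\<Sum>b\<in>UNIV. N b a * fst s $ b)) *\<^sub>R prol_basis A c f \<mu> k)"

lemma linear_frame_map: "linear (frame_map A c f N \<mu>)"
proof -
  have "linear (\<lambda>s. (case k of Inl a \<Rightarrow> fst s $ a
     | Inr a \<Rightarrow> snd s $ a - (\<Sum>b\<in>UNIV. N b a * fst s $ b)) *\<^sub>R prol_basis A c f \<mu> k)" for k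
    by (cases k) (auto intro!: linearI
        simp: sum.distrib sum_distrib_left algebra_simps)
  then show ?thesis
    unfolding frame_map_def by (intro linear_compose_sum) auto
qed

text \<open>The change between the two coframes is triangular with ones on the diagonal, hence
  invertible for every \<open>N\<close>.\<close>

lemma frame_map_bij:
  fixes A :: "('x::{t2_space,second_countable_topology}, 'v::real_vector, 'n::finite, 'm::finite) algebroid"
  assumes A: "vector_bundle A" "smooth_anchor A" "c \<in> charts A" "f \<in> frames A"
    and \<mu>: "\<mu> \<in> fst (dual_chart A c f)"
  shows "inj (frame_map A c f N \<mu>)" "range (frame_map A c f N \<mu>) = prolongation A \<mu>"
proof -
  show "inj (frame_map A c f N \<mu>)"
    unfolding linear_injective_0[OF linear_frame_map]
  proof (intro allI impI)
    fix s :: "(real^'m) \<times> (real^'m)" assume "frame_map A c f N \<mu> s = 0"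
    note K = prol_basis_kernel[OF A \<mu> this[unfolded frame_map_def]]
    have "fst s = 0" using K[of "Inl _"] by (simp add: vec_eq_iff)
    moreover from this have "snd s = 0" using K[of "Inr _"] by (simp add: vec_eq_iff)
    ultimately show "s = 0" by (simp add: prod_eq_iff)
  qed
  show "range (frame_map A c f N \<mu>) = prolongation A \<mu>"
    unfolding prolongation_eq_range[OF A \<mu>]
  proof (intro equalityI subsetI)
    fix X assume "X \<in> range (\<lambda>u. \<Sum>k\<in>UNIV. u k *\<^sub>R prol_basis A c f \<mu> k)"
    then obtain u where X: "X = (\<Sum>k\<in>UNIV. u k *\<^sub>R prol_basis A c f \<mu> k)" by blast
    \<comment> \<open>The terms in \<open>N\<close> that \<open>frame_map\<close> subtracts are
      added beforehand.\<close>
    have "X = frame_map A c f N \<mu> (\<chi> a. u (Inl a), \<chi> a. u (Inr a) + (\<Sum>b\<in>UNIV. N b a * u (Inl b)))"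
      unfolding X frame_map_def by (intro sum.cong refl) (simp split: sum.split)
    then show "X \<in> range (frame_map A c f N \<mu>)" by blast
  qed (auto simp: frame_map_def)
qed

section \<open>The d-metric\<close>

lemma smooth_on_rho:
  assumes "smooth_anchor A" "c \<in> charts A" "f \<in> frames A" "open T" "fst ` T \<subseteq> snd c ` (fst c \<inter> fst f)"
  shows "smooth_on T (\<lambda>w. rho A c f i a (fst w))"
proof -
  have "smooth_on (snd c ` (fst c \<inter> fst f)) (in_chart c (\<lambda>x. anchor A x (snd f x a) c))"
    using assms(1-3) unfolding smooth_anchor_def by blast
  from smooth_on_vec_nth[OF assms(4) smooth_on_compose_fst[OF assms(4,5) this], of i]
  show ?thesis by (simp add: rho_def in_chart_def)
qed

lemma smooth_on_structure_fun:
  assumes A: "vector_bundle A" "lie_bracket A" and c: "c \<in> charts A" and f: "f \<in> frames A"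
    and T: "open T" "fst ` T \<subseteq> snd c ` (fst c \<inter> fst f)"
  shows "smooth_on T (\<lambda>w. structure_fun A c f e a b (fst w))"
proof -
  have "smooth_section A (fst f) (bracket A (fst f) (\<lambda>x. snd f x a) (\<lambda>x. snd f x b))"
    using A(2) vector_bundleD(3)[OF A(1) f] vector_bundleD(7)[OF A(1) f]
    unfolding lie_bracket_def by simp
  then have "smooth_on (snd c ` (fst f \<inter> fst c \<inter> fst f))
     (in_chart c (\<lambda>x. frame_coord f x (bracket A (fst f) (\<lambda>x. snd f x a) (\<lambda>x. snd f x b) x)))"
    using c f unfolding smooth_section_def by blast
  moreover have "fst f \<inter> fst c \<inter> fst f = fst c \<inter> fst f" by blast
  ultimately have "smooth_on (snd c ` (fst c \<inter> fst f))
     (in_chart c (\<lambda>x. frame_coord f x (bracket A (fst f) (\<lambda>x. snd f x a) (\<lambda>x. snd f x b) x)))"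
    by simp
  from smooth_on_vec_nth[OF T(1) smooth_on_compose_fst[OF T this], of e]
  show ?thesis by (simp add: structure_fun_def in_chart_def)
qed

lemma smooth_on_pd:
  assumes "smooth_on S F"
  shows "smooth_on S (pd_x i F)" "smooth_on S (pd_p a F)"
  using smooth_on_frechet_derivative[OF assms] by (simp_all add: pd_x_def[abs_def] pd_p_def[abs_def])

lemma smooth_on_h_up:
  assumes "open S" "smooth_on S H"
  shows "smooth_on S (\<lambda>w. h_up H w $ a $ b)"
  unfolding h_up_def vec_lambda_beta
  by (intro smooth_on_mult smooth_on_const smooth_on_pd assms)

lemma smooth_on_h_low:
  assumes "open S" "smooth_on S H" "\<And>w. w \<in> S \<Longrightarrow> invertible (h_up H w)"
  shows "smooth_on S (\<lambda>w. h_low H w $ a $ b)"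
  unfolding h_low_def by (rule smooth_on_matrix_inv[OF assms(1) smooth_on_h_up[OF assms(1,2)] assms(3)])

text \<open>The Poisson bracket differentiates the entries of the inverse matrix, so these must be
  smooth on an open set, with invertibility at each of its points.\<close>

lemma smooth_on_canonical_N:
  assumes A: "lie_algebroid A" and c: "c \<in> charts A" and f: "f \<in> frames A"
    and T: "open T" "fst ` T \<subseteq> snd c ` (fst c \<inter> fst f)"
    and H: "smooth_on T H" "\<And>w. w \<in> T \<Longrightarrow> invertible (h_up H w)"
  shows "smooth_on T (canonical_N A c f H a b)"
proof -
  have A': "vector_bundle A" "smooth_anchor A" "lie_bracket A"
    using A unfolding lie_algebroid_def by auto
  have p: "smooth_on T (\<lambda>w. snd w $ e)" for e
    by (rule smooth_on_linear[OF _ T(1)])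
      (auto intro: bounded_linear_compose[OF bounded_linear_vec_nth] bounded_linear_snd)
  show ?thesis
    unfolding canonical_N_def[abs_def] poisson_def
    by (intro smooth_on_diff smooth_on_add smooth_on_mult smooth_on_sum smooth_on_const T(1)
        smooth_on_pd smooth_on_h_low[OF T(1) H] H(1) p
        smooth_on_rho[OF A'(2) c f T] smooth_on_structure_fun[OF A'(1,3) c f T])
qed

text \<open>Every element of \<open>V\<close> is some \<open>L s\<close>, so each algebraic clause
  in the definition of a metric turns into one about the form \<open>B\<close> on the whole
  space.\<close>

lemma linear_isometry_metric:
  fixes L :: "'w::real_vector \<Rightarrow> 'u::real_vector"
  assumes L: "linear L" "range L = V" and B: "bilinear B" and g: "\<And>s t. g (L s) (L t) = B s t"
  shows "bilinear_form_on V g"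
    and "(\<And>s t. B s t = B t s) \<Longrightarrow> X \<in> V \<Longrightarrow> Y \<in> V \<Longrightarrow> g X Y = g Y X"
    and "(\<And>s. (\<And>t. B s t = 0) \<Longrightarrow> s = 0) \<Longrightarrow> X \<in> V \<Longrightarrow> (\<And>Y. Y \<in> V \<Longrightarrow> g X Y = 0) \<Longrightarrow> X = 0"
proof -
  have g_add: "g (L s + L t) (L r) = B s r + B t r" "g (L r) (L s + L t) = B r s + B r t"
    and g_scale: "g (a *\<^sub>R L s) (L t) = a * B s t" "g (L s) (a *\<^sub>R L t) = a * B s t" for s t r a
    unfolding linear_add[OF L(1), symmetric] linear_scale[OF L(1), symmetric] g
    by (simp_all add: bilinear_ladd[OF B] bilinear_radd[OF B] bilinear_lmul[OF B] bilinear_rmul[OF B])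
  show "bilinear_form_on V g"
    unfolding bilinear_form_on_def L(2)[symmetric] by (auto simp: g_add g_scale g)
  show "g X Y = g Y X" if "\<And>s t. B s t = B t s" "X \<in> V" "Y \<in> V"
    using that(2,3) unfolding L(2)[symmetric] by (auto simp: g that(1))
  show "X = 0" if nd: "\<And>s. (\<And>t. B s t = 0) \<Longrightarrow> s = 0" and X: "X \<in> V" "\<And>Y. Y \<in> V \<Longrightarrow> g X Y = 0"
  proof -
    obtain s where s: "X = L s" using X(1) L(2) by blast
    have "B s t = 0" for t
      using X(2)[of "L t"] L(2) unfolding s g by blast
    then show ?thesis using nd[of s] linear_0[OF L(1)] by (simp add: s)
  qed
qed

theorem theorem5p3:
  fixes A :: "('x::{t2_space,second_countable_topology}, 'v::real_vector, 'n::finite, 'm::finite) algebroid"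
    and h :: "'x \<times> ('v \<Rightarrow> real) \<Rightarrow> real"
    and c :: "('x, real^'n) chart"
    and f :: "('x, 'v, 'm) frame"
  assumes "hamilton_algebroid A h"
    and "c \<in> charts A" and "f \<in> frames A"
  defines "d \<equiv> dual_chart A c f"
  defines "H \<equiv> in_chart d h"
  shows "prolongation_metric A c f (\<lambda>\<mu> X Y.
    (\<Sum>a\<in>UNIV. \<Sum>b\<in>UNIV. h_low H (snd d \<mu>) $ a $ b * z_co A c f a \<mu> X * z_co A c f b \<mu> Y) +
    (\<Sum>a\<in>UNIV. \<Sum>b\<in>UNIV. h_up H (snd d \<mu>) $ a $ b * v_co A c f H a \<mu> X * v_co A c f H b \<mu> Y))"
    (is "prolongation_metric A c f ?g")
proof -
  note cf = assms(2,3)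
  define D where "D = slit_dual A \<inter> fst d"
  define S where "S = snd d ` D"
  have lie: "lie_algebroid A"
    using assms(1) unfolding hamilton_algebroid_def by blast
  then have A: "vector_bundle A" "smooth_anchor A"
    unfolding lie_algebroid_def by auto
  have H: "smooth_on S H" and inv: "\<And>\<mu>. \<mu> \<in> D \<Longrightarrow> invertible (h_up H (snd d \<mu>))"
    using assms(1) cf unfolding hamilton_algebroid_def Let_def S_def D_def H_def d_def by blast+
  \<comment> \<open>A single pair for all points of \<open>D\<close>; its double is the signature
    asserted for the d-metric.\<close>
  obtain p q where sig: "\<And>\<mu>. \<mu> \<in> D \<Longrightarrow> has_signature UNIV (\<lambda>v w. v \<bullet> (h_up H (snd d \<mu>) *v w)) p q"
    using assms(1) cf unfolding hamilton_algebroid_def Let_def S_def D_def H_def d_def by blast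
  have S: "open S" "fst ` S \<subseteq> snd c ` (fst c \<inter> fst f)"
    using open_slit_dual_image[OF A(1) cf(2,1)] slit_dual_image[OF A(1) cf(2), of c]
    unfolding S_def D_def d_def by auto
  define N where "N \<mu> b a = canonical_N A c f H b a (snd d \<mu>)" for \<mu> b a
  define L where "L \<mu> = frame_map A c f (N \<mu>) \<mu>" for \<mu>
  define B where "B \<mu> s t = fst s \<bullet> (h_low H (snd d \<mu>) *v fst t) + snd s \<bullet> (h_up H (snd d \<mu>) *v snd t)"
    for \<mu> and s t :: "(real^'m) \<times> (real^'m)"
  have Dd: "\<mu> \<in> fst (dual_chart A c f)" if "\<mu> \<in> D" for \<mu>
    using that unfolding D_def d_def by blast
  have gL: "?g \<mu> (L \<mu> s) (L \<mu> t) = B \<mu> s t" if "\<mu> \<in> D" for \<mu> s t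
  proof -
    \<comment> \<open>The term with the connection in \<open>v_co\<close> cancels the one subtracted
      in \<open>frame_map\<close>, so the coframe returns exactly the coordinates
      \<open>s\<close>.\<close>
    have z: "z_co A c f a \<mu> (L \<mu> s) = fst s $ a" and v: "v_co A c f H a \<mu> (L \<mu> s) = snd s $ a" for a s
      using prol_cobasis_sum[OF A cf Dd[OF that]]
      by (simp_all add: z_co_def v_co_def L_def frame_map_def N_def flip: d_def)
    show ?thesis
      unfolding z v inner_matrix_sum B_def ..
  qed
  have L: "linear (L \<mu>)" for \<mu>
    unfolding L_def by (rule linear_frame_map)
  have Lr: "inj (L \<mu>)" "range (L \<mu>) = prolongation A \<mu>" if "\<mu> \<in> D" for \<mu>
    unfolding L_def by (rule frame_map_bij[OF A cf Dd[OF that]])+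
  have bilB: "bilinear (B \<mu>)" for \<mu>
    unfolding B_def[abs_def] bilinear_def
    by (auto intro!: linearI simp: inner_add_left inner_add_right matrix_vector_right_distrib
        matrix_vector_mult_scaleR algebra_simps)
  have sigB: "has_signature UNIV (B \<mu>) (p + p) (q + q)" if "\<mu> \<in> D" for \<mu>
    using has_signature_prod[OF bilinear_inner_matrix bilinear_inner_matrix
        has_signature_matrix_inv[OF inv[OF that] sig[OF that]] sig[OF that]]
    unfolding B_def[abs_def] h_low_def .
  have sym: "transpose (h_up H (snd d \<mu>)) = h_up H (snd d \<mu>)"
    "transpose (h_low H (snd d \<mu>)) = h_low H (snd d \<mu>)" if "\<mu> \<in> D" for \<mu>
    using has_signature_imp_symmetric[OF sig[OF that]] transpose_matrix_inv[OF inv[OF that]]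
    by (simp_all add: h_low_def)
  have symB: "B \<mu> s t = B \<mu> t s" if "\<mu> \<in> D" for \<mu> s t
    using inner_matrix_transpose[of "fst s" "h_low H (snd d \<mu>)" "fst t"]
      inner_matrix_transpose[of "snd s" "h_up H (snd d \<mu>)" "snd t"]
    by (simp add: B_def sym[OF that])
  have ndB: "s = 0" if \<mu>: "\<mu> \<in> D" and 0: "\<And>t. B \<mu> s t = 0" for \<mu> s
  proof -
    let ?M = "h_up H (snd d \<mu>)"
    \<comment> \<open>The test vectors undo the blocks: pairing with the image of a component under
      the inverse of its block leaves the squared length of that component.\<close>
    have "fst s \<bullet> fst s = 0"
      using 0[of "(?M *v fst s, 0)"]
      by (simp add: B_def h_low_def matrix_vector_mul_assoc matrix_inv_works(2)[OF inv[OF \<mu>]])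
    moreover have "snd s \<bullet> snd s = 0"
      using 0[of "(0, h_low H (snd d \<mu>) *v snd s)"]
      by (simp add: B_def h_low_def matrix_vector_mul_assoc matrix_inv_works(1)[OF inv[OF \<mu>]])
    ultimately show ?thesis by (simp add: prod_eq_iff)
  qed
  have sigg: "has_signature (prolongation A \<mu>) (?g \<mu>) (p + p) (q + q)" if "\<mu> \<in> D" for \<mu>
    using has_signature_linear_image[OF L Lr(1)[OF that] sigB[OF that] gL[OF that]]
    unfolding Lr(2)[OF that] .
  have smooth: "smooth_on S (in_chart d (\<lambda>\<mu>. ?g \<mu> (prol_basis A c f \<mu> k) (prol_basis A c f \<mu> l)))" for k l
  proof -
    \<comment> \<open>On basis sections the dual basis takes Kronecker values, so the components of
      the metric depend on the point only through the two matrices and the coefficients of the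
      connection.\<close>
    define \<delta> where "\<delta> k l = (if k = l then 1 else 0 :: real)" for k l :: "'m + 'm"
    define Z where "Z a k = \<delta> (Inl a) k" for a k
    define V where "V a k w = \<delta> (Inr a) k + (\<Sum>b\<in>UNIV. canonical_N A c f H b a w * \<delta> (Inl b) k)" for a k w
    have invS: "\<And>w. w \<in> S \<Longrightarrow> invertible (h_up H w)"
      using inv unfolding S_def by blast
    have V: "smooth_on S (V a k)" for a k
      unfolding V_def[abs_def]
      by (intro smooth_on_add smooth_on_sum smooth_on_mult smooth_on_const S(1)
          smooth_on_canonical_N[OF lie cf S H invS])
    have "smooth_on S (\<lambda>w. (\<Sum>a\<in>UNIV. \<Sum>b\<in>UNIV. h_low H w $ a $ b * Z a k * Z b l) +
        (\<Sum>a\<in>UNIV. \<Sum>b\<in>UNIV. h_up H w $ a $ b * V a k w * V b l w))"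
      by (intro smooth_on_add smooth_on_sum smooth_on_mult smooth_on_const S(1) V
          smooth_on_h_up[OF S(1) H] smooth_on_h_low[OF S(1) H invS])
    then show ?thesis
    proof (rule smooth_on_cong[OF S(1)])
      fix w assume "w \<in> S"
      then obtain \<mu> where \<mu>: "\<mu> \<in> D" "w = snd d \<mu>" unfolding S_def by blast
      have *: "in_chart d F w = F \<mu>" for F :: "_ \<Rightarrow> real"
        unfolding \<mu>(2) d_def by (rule in_chart_chart[OF inj_on_dual_chart[OF A(1) cf(2,1)] Dd[OF \<mu>(1)]])
      have z: "z_co A c f a \<mu> (prol_basis A c f \<mu> k) = Z a k"
        and v: "v_co A c f H a \<mu> (prol_basis A c f \<mu> k) = V a k w" for a k
        unfolding z_co_def v_co_def Z_def V_def \<delta>_def prol_cobasis_basis[OF A cf Dd[OF \<mu>(1)]]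
        by (simp_all add: \<mu>(2) flip: d_def)
      show "(\<Sum>a\<in>UNIV. \<Sum>b\<in>UNIV. h_low H w $ a $ b * Z a k * Z b l) +
        (\<Sum>a\<in>UNIV. \<Sum>b\<in>UNIV. h_up H w $ a $ b * V a k w * V b l w)
        = in_chart d (\<lambda>\<mu>. ?g \<mu> (prol_basis A c f \<mu> k) (prol_basis A c f \<mu> l)) w"
        unfolding * z v \<mu>(2)[symmetric] ..
    qed
  qed
  note M = linear_isometry_metric[OF L Lr(2) bilB gL]
  show ?thesis
    unfolding prolongation_metric_def Let_def d_def[symmetric] D_def[symmetric] S_def[symmetric]
  proof (intro conjI ballI allI impI exI)
    fix \<mu> assume \<mu>: "\<mu> \<in> D"
    show "bilinear_form_on (prolongation A \<mu>) (?g \<mu>)"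
      by (rule M(1)[OF \<mu> \<mu>])
    show "has_signature (prolongation A \<mu>) (?g \<mu>) (p + p) (q + q)"
      by (rule sigg[OF \<mu>])
    fix X assume X: "X \<in> prolongation A \<mu>"
    show "?g \<mu> X Y = ?g \<mu> Y X" if "Y \<in> prolongation A \<mu>" for Y
      by (rule M(2)[OF \<mu> \<mu> symB[OF \<mu>] X that])
    show "X = 0" if "\<forall>Y\<in>prolongation A \<mu>. ?g \<mu> X Y = 0"
      by (rule M(3)[OF \<mu> \<mu> ndB[OF \<mu>] X]) (use that in auto)
  qed (rule smooth)
qed

end
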